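(* Let $X$ be a finite simplicial complex, let $\alpha \in Z^2(X;\mathbb{Z})$ be an integral simplicial $2$-cocycle, and fix a base-point $p\in S^2$. Let $\hat\alpha \colon \mathrm{sk}_2(X)\to S^2$ be the map that sends every vertex and every $1$-simplex of $X$ to $p$ and that, on each $2$-simplex $\varphi$ of $X$, is the map $\varphi\to S^2$ obtained by collapsing $\partial\varphi$ to a point to obtain a $2$-sphere $\varphi/\partial\varphi$ and then mapping this sphere to $S^2$ by a base-point preserving map of degree $\alpha(\varphi)$. Then $\hat\alpha$ extends to a continuous map $\tilde\alpha\colon \mathrm{sk}_3(X)\to S^2$.
   Context: $\mathrm{sk}_n(X)$ is (the geometric realization of) the $n$-skeleton of $X$. Order the vertices of $X$, so that each simplex is oriented by the induced order of its vertices. A $2$-cochain is a function assigning an integer to each $2$-simplex; it is a cocycle, i.e. lies in $Z^2(X;\mathbb{Z})$, if $\alpha(bcd)-\alpha(acd)+\alpha(abd)-\alpha(abc)=0$ for each $3$-simplex $abcd$ (vertices in order). Fix an orientation of $S^2$; the degree of a map $\varphi/\partial\varphi\to S^2$ is taken with respect to the orientation of $\varphi/\partial\varphi$ coming from the orientation of $\varphi$, and the base-point of $\varphi/\partial\varphi$ is the collapsed boundary. *)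

theory Defs
  imports "HOL-Analysis.Analysis" "HOL-Homology.Homology"
begin

section \<open>Simplicial complexes and cochains\<close>

definition complex_vertices :: "'a set set \<Rightarrow> 'a set"
  where "complex_vertices X = {v. {v} \<in> X}"

definition skeleton :: "nat \<Rightarrow> 'a::euclidean_space set set \<Rightarrow> 'a set set"
  where "skeleton n X = {S \<in> X. aff_dim S \<le> int n}"

text \<open>The list \<open>vs\<close> enumerates the vertices of the simplex \<open>S\<close> increasingly
  with respect to the (reflexive) order \<open>r\<close>.\<close>

definition simplex_in_order :: "('a \<times> 'a) set \<Rightarrow> 'a list \<Rightarrow> 'a::euclidean_space set \<Rightarrow> bool"
  where "simplex_in_order r vs S \<longleftrightarrow>
    sorted_wrt (\<lambda>x y. (x, y) \<in> r \<and> x \<noteq> y) vs \<and>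
    \<not> affine_dependent (set vs) \<and> S = convex hull (set vs)"

text \<open>Cochains are total functions on sets; only the values on the 2-simplices of \<open>X\<close>,
  oriented by \<open>r\<close>, matter.\<close>

definition cocycles2 :: "('a \<times> 'a) set \<Rightarrow> 'a::euclidean_space set set \<Rightarrow> ('a set \<Rightarrow> int) set"
  where "cocycles2 r X = {\<alpha>. \<forall>T \<in> X. \<forall>a b c d. simplex_in_order r [a, b, c, d] T \<longrightarrow>
    \<alpha> (convex hull {b, c, d}) - \<alpha> (convex hull {a, c, d})
      + \<alpha> (convex hull {a, b, d}) - \<alpha> (convex hull {a, b, c}) = 0}"


section \<open>Collapsing a subset to a point\<close>

text \<open>Points of the quotient of \<open>X\<close> by \<open>A\<close> are equivalence classes, so the collapsed
  set \<open>A\<close> (assumed nonempty) is itself the base-point.\<close>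

definition collapse :: "'a set \<Rightarrow> 'a \<Rightarrow> 'a set"
  where "collapse A x = (if x \<in> A then A else {x})"

definition collapse_topology :: "'a topology \<Rightarrow> 'a set \<Rightarrow> 'a set topology"
  where "collapse_topology X A = topology (\<lambda>U. U \<subseteq> collapse A ` topspace X \<and>
    openin X {x \<in> topspace X. collapse A x \<in> U})"

lemma openin_collapse_topology:
  "openin (collapse_topology X A) U \<longleftrightarrow>
    U \<subseteq> collapse A ` topspace X \<and> openin X {x \<in> topspace X. collapse A x \<in> U}"
proof -
  let ?P = "\<lambda>U. U \<subseteq> collapse A ` topspace X \<and> openin X {x \<in> topspace X. collapse A x \<in> U}"
  have "istopology ?P"
    unfolding istopology_def
  proof (intro conjI allI impI; (elim conjE)?)
    fix S T
    assume "openin X {x \<in> topspace X. collapse A x \<in> S}" "openin X {x \<in> topspace X. collapse A x \<in> T}"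
    then have "openin X ({x \<in> topspace X. collapse A x \<in> S} \<inter> {x \<in> topspace X. collapse A x \<in> T})"
      by (rule openin_Int)
    moreover have "{x \<in> topspace X. collapse A x \<in> S} \<inter> {x \<in> topspace X. collapse A x \<in> T}
        = {x \<in> topspace X. collapse A x \<in> S \<inter> T}" by auto
    ultimately show "openin X {x \<in> topspace X. collapse A x \<in> S \<inter> T}" by simp
  next
    fix K assume "\<forall>S\<in>K. ?P S"
    then have "openin X (\<Union>S\<in>K. {x \<in> topspace X. collapse A x \<in> S})" by blast
    moreover have "(\<Union>S\<in>K. {x \<in> topspace X. collapse A x \<in> S})
        = {x \<in> topspace X. collapse A x \<in> \<Union>K}" by auto
    ultimately show "openin X {x \<in> topspace X. collapse A x \<in> \<Union>K}" by simp
  qed blast+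
  then show ?thesis
    by (simp add: collapse_topology_def)
qed

lemma topspace_collapse_topology: "topspace (collapse_topology X A) = collapse A ` topspace X"
proof -
  have "{x \<in> topspace X. collapse A x \<in> collapse A ` topspace X} = topspace X" by auto
  then have "openin (collapse_topology X A) (collapse A ` topspace X)"
    by (simp add: openin_collapse_topology)
  then show ?thesis
    by (meson openin_collapse_topology openin_subset openin_topspace subset_antisym)
qed

lemma quotient_map_collapse: "quotient_map X (collapse_topology X A) (collapse A)"
  by (auto simp: quotient_map_def openin_collapse_topology topspace_collapse_topology)


section \<open>Orientations and degrees\<close>

definition sphere_orientation :: "(nat \<Rightarrow> real) chain set \<Rightarrow> bool"
  where "sphere_orientation \<omega> \<longleftrightarrow>
    \<omega> \<in> carrier (homology_group 2 (nsphere 2)) \<and>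
    subgroup_generated (homology_group 2 (nsphere 2)) {\<omega>} = homology_group 2 (nsphere 2)"

text \<open>\<^const>\<open>oriented_simplex\<close> only covers vertices of type \<^typ>\<open>nat \<Rightarrow> real\<close>.\<close>

definition affine_triangle :: "'a \<Rightarrow> 'a \<Rightarrow> 'a \<Rightarrow> (nat \<Rightarrow> real) \<Rightarrow> 'a::euclidean_space"
  where "affine_triangle a b c =
    (\<lambda>t \<in> standard_simplex 2. t 0 *\<^sub>R a + t 1 *\<^sub>R b + t 2 *\<^sub>R c)"

abbreviation triangle_mod_boundary :: "'a::euclidean_space set \<Rightarrow> 'a set topology"
  where "triangle_mod_boundary \<phi> \<equiv> collapse_topology (top_of_set \<phi>) (rel_frontier \<phi>)"

text \<open>The orientation of the sphere \<open>\<phi>/\<partial>\<phi>\<close> coming from the vertex order \<open>a, b, c\<close> of the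
  triangle \<open>\<phi>\<close>: the class \<open>u\<close> corresponding to the fundamental class of \<open>(\<phi>, \<partial>\<phi>)\<close> under
  \<open>H\<^sub>2(\<phi>, \<partial>\<phi>) \<rightarrow> H\<^sub>2(\<phi>/\<partial>\<phi>, *) \<leftarrow> H\<^sub>2(\<phi>/\<partial>\<phi>)\<close>, where both maps are isomorphisms.\<close>

definition quotient_orientation ::
  "'a::euclidean_space \<Rightarrow> 'a \<Rightarrow> 'a \<Rightarrow> 'a set \<Rightarrow> 'a set chain set \<Rightarrow> bool"
  where "quotient_orientation a b c \<phi> u \<longleftrightarrow>
    u \<in> carrier (homology_group 2 (triangle_mod_boundary \<phi>)) \<and>
    hom_induced 2 (triangle_mod_boundary \<phi>) {} (triangle_mod_boundary \<phi>) {rel_frontier \<phi>} id u =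
    hom_induced 2 (top_of_set \<phi>) (rel_frontier \<phi>) (triangle_mod_boundary \<phi>) {rel_frontier \<phi>}
      (collapse (rel_frontier \<phi>))
      (homologous_rel_set 2 (top_of_set \<phi>) (rel_frontier \<phi>) (frag_of (affine_triangle a b c)))"

text \<open>The degree of \<open>g\<close> between 2-spheres oriented by \<open>u\<close> and \<open>\<omega>\<close>, as in
  \<^const>\<open>Brouwer_degree2\<close>, which is limited to self-maps of \<^const>\<open>nsphere\<close>.\<close>

definition has_degree ::
  "'a topology \<Rightarrow> 'a chain set \<Rightarrow> (nat \<Rightarrow> real) chain set \<Rightarrow> ('a \<Rightarrow> nat \<Rightarrow> real) \<Rightarrow> int \<Rightarrow> bool"
  where "has_degree Y u \<omega> g d \<longleftrightarrow>
    hom_induced 2 Y {} (nsphere 2) {} g u = \<omega> [^]\<^bsub>homology_group 2 (nsphere 2)\<^esub> d"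

end

theory Submission
  imports Defs
begin

text \<open>The extension problem is local: on a 3-simplex \<open>T = abcd\<close> the map is given on the
  boundary, a 2-sphere, where all edges go to \<open>p\<close> and the four faces are mapped with
  degrees \<open>\<alpha>(bcd)\<close>, \<open>\<alpha>(acd)\<close>, \<open>\<alpha>(abd)\<close>, \<open>\<alpha>(abc)\<close>. Their alternating sum vanishes because
  \<open>\<alpha>\<close> is a cocycle, so the boundary map has degree zero and should be null-homotopic.
  Instead of quoting Hopf's theorem on maps of degree zero, the proof lifts the boundary
  map through the Hopf map from \<open>\<complex>\<^sup>2 - {0}\<close> to \<open>S\<^sup>2\<close>. A map from a 2-sphere to \<open>\<complex>\<^sup>2 - {0}\<close>
  extends over the ball because \<open>\<complex>\<^sup>2 - {0}\<close> retracts onto \<open>S\<^sup>3\<close>; composing with the Hopf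
  map gives the extension (\<open>tetrahedron_extension\<close>).

  The obstruction to lifting is measured by a singular 2-cochain on \<open>S\<^sup>2\<close>. Maps of
  contractible compact spaces lift (\<open>hopf_lift\<close>), and two lifts differ by a factor that
  has a continuous logarithm (\<open>hopf_lifts_differ_by_exp\<close>). Fix a lift for every singular
  1-simplex. A lift of a singular triangle differs from the fixed lifts along its edges,
  and the total change of the logarithms of these factors around the boundary is the
  obstruction of the triangle. It does not depend on the lift of the triangle
  (\<open>obstruction_eq\<close>). It is a cocycle, as one sees by lifting a singular 3-simplex as a
  whole (\<open>obstruction_cocycle\<close>), and it vanishes on constant triangles. So it defines a
  homomorphism from \<open>H\<^sub>2(S\<^sup>2, p)\<close> to the complex numbers
  (\<open>chain_obstruction_relboundary\<close>), and a triangle that is mapped with degree \<open>n\<close> has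
  obstruction \<open>n\<close> times a constant depending only on the orientation of \<open>S\<^sup>2\<close>
  (\<open>obstruction_of_degree\<close>). In this way the definition of the degree by homology classes
  enters only through the additivity of a cochain.

  For the tetrahedron, the cocycle condition on \<open>\<alpha>\<close> says that a lift over the three faces at
  \<open>a\<close> and a lift over the face \<open>bcd\<close> differ on the boundary of \<open>bcd\<close> by a factor of
  winding number zero. Such a factor extends over \<open>bcd\<close> without zeros, which permits the
  two lifts to be glued (\<open>hopf_lift_tetrahedron_boundary\<close>).\<close>

section \<open>Lifting along a contraction\<close>

text \<open>Compactness is included since lifting along the homotopy relies on uniform
  continuity.\<close>
definition contracts_to :: "'k::metric_space set \<Rightarrow> 'k \<Rightarrow> bool"
  where "contracts_to K x0 \<longleftrightarrow> compact K \<and> x0 \<in> K \<and>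
    (\<exists>H. continuous_on ({0..1::real} \<times> K) H \<and> H ` ({0..1} \<times> K) \<subseteq> K \<and>
      (\<forall>x\<in>K. H (0, x) = x0 \<and> H (1, x) = x))"

text \<open>Moving along the contraction in sufficiently many small steps, the values of \<open>f\<close>
  move by less than \<open>\<delta>\<close> at each step, uniformly by compactness. The constant lift at time
  0 can therefore be transported step by step to a lift of \<open>f\<close> at time 1. Here \<open>R e y\<close>
  says that \<open>e\<close> lies over \<open>y\<close>, and \<open>tr\<close> moves a point over \<open>y'\<close> to a point over a nearby
  \<open>y\<close>.\<close>
lemma lift_by_local_transport:
  fixes f :: "'k::metric_space \<Rightarrow> 'y::metric_space"
    and tr :: "'e::topological_space \<times> 'y \<Rightarrow> 'e" and R :: "'e \<Rightarrow> 'y \<Rightarrow> bool"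
  assumes K: "contracts_to K x0" and f: "continuous_on K f" and "\<delta> > 0"
    and tr: "continuous_on {(e, y). y \<in> f ` K \<and> (\<exists>y' \<in> f ` K. R e y' \<and> dist y' y < \<delta>)} tr"
    and R: "\<And>e y y'. \<lbrakk>R e y'; y \<in> f ` K; y' \<in> f ` K; dist y' y < \<delta>\<rbrakk> \<Longrightarrow> R (tr (e, y)) y"
    and e0: "R e0 (f x0)"
  obtains s where "continuous_on K s" "\<And>x. x \<in> K \<Longrightarrow> R (s x) (f x)"
proof -
  obtain H where H: "continuous_on ({0..1::real} \<times> K) H" "H ` ({0..1} \<times> K) \<subseteq> K"
    and H0: "\<And>x. x \<in> K \<Longrightarrow> H (0, x) = x0" and H1: "\<And>x. x \<in> K \<Longrightarrow> H (1, x) = x"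
    and "compact K"
    using K unfolding contracts_to_def by blast
  have cfH: "continuous_on ({0..1::real} \<times> K) (f \<circ> H)"
    by (intro continuous_on_compose H(1) continuous_on_subset [OF f H(2)])
  have "uniformly_continuous_on ({0..1::real} \<times> K) (f \<circ> H)"
    by (intro compact_uniformly_continuous cfH compact_Times \<open>compact K\<close> compact_Icc)
  then obtain \<eta> where "\<eta> > 0" and \<eta>: "\<And>z z'. \<lbrakk>z \<in> {0..1} \<times> K; z' \<in> {0..1} \<times> K; dist z' z < \<eta>\<rbrakk>
      \<Longrightarrow> dist (f (H z')) (f (H z)) < \<delta>"
    unfolding uniformly_continuous_on_def comp_apply using \<open>\<delta> > 0\<close> by metis
  obtain m where "inverse (real (Suc m)) < \<eta>"
    using reals_Archimedean [OF \<open>\<eta> > 0\<close>] ..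
  then obtain n :: nat where n: "n > 0" "1 / real n < \<eta>"
    by (metis inverse_eq_divide zero_less_Suc)
  have "\<exists>s. continuous_on K s \<and> (\<forall>x\<in>K. R (s x) (f (H (real i / real n, x))))" if "i \<le> n" for i
    using that
  proof (induction i)
    case 0
    show ?case
      by (rule exI [of _ "\<lambda>x. e0"]) (use e0 H0 in auto)
  next
    case (Suc i)
    then obtain s where s: "continuous_on K s"
      and Rs: "\<And>x. x \<in> K \<Longrightarrow> R (s x) (f (H (real i / real n, x)))" by auto
    define y where "y = (\<lambda>x. f (H (real (Suc i) / real n, x)))"
    define y' where "y' = (\<lambda>x. f (H (real i / real n, x)))"
    have 01: "real (Suc i) / real n \<in> {0..1}" "real i / real n \<in> {0..1}"
      using Suc.prems n by auto
    have HK: "H (real (Suc i) / real n, x) \<in> K" "H (real i / real n, x) \<in> K" if "x \<in> K" for x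
      using that 01 by (auto intro!: subsetD [OF H(2)])
    then have im: "y x \<in> f ` K" "y' x \<in> f ` K" if "x \<in> K" for x
      using that by (simp_all add: y_def y'_def)
    have Rs': "R (s x) (y' x)" if "x \<in> K" for x
      using Rs [OF that] by (simp add: y'_def)
    have near: "dist (y' x) (y x) < \<delta>" if "x \<in> K" for x
    proof -
      have "real i / real n - real (Suc i) / real n = - (1 / real n)"
        using n by (simp add: field_simps)
      then have "\<bar>real i / real n - real (Suc i) / real n\<bar> = 1 / real n"
        by simp
      then have "dist (real i / real n, x) (real (Suc i) / real n, x) < \<eta>"
        using n(2) by (simp add: dist_Pair_Pair dist_real_def)
      then show ?thesis
        unfolding y_def y'_def using that 01 by (intro \<eta>) auto
    qed
    have "continuous_on K (\<lambda>x. (f \<circ> H) (real (Suc i) / real n, x))"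
      using 01 by (intro continuous_on_compose2 [OF cfH] continuous_on_Pair continuous_on_const continuous_on_id) blast
    then have cy: "continuous_on K y"
      by (simp add: y_def)
    have "continuous_on K (\<lambda>x. tr (s x, y x))"
    proof (rule continuous_on_compose2 [OF tr])
      show "continuous_on K (\<lambda>x. (s x, y x))"
        using s cy by (intro continuous_intros)
      show "(\<lambda>x. (s x, y x)) ` K \<subseteq> {(e, y). y \<in> f ` K \<and> (\<exists>y'\<in>f ` K. R e y' \<and> dist y' y < \<delta>)}"
        using im near Rs' by blast
    qed
    moreover have "R (tr (s x, y x)) (y x)" if "x \<in> K" for x
      by (intro R [OF Rs'] im near that)
    ultimately have "continuous_on K (\<lambda>x. tr (s x, y x)) \<and> (\<forall>x\<in>K. R (tr (s x, y x)) (y x))"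
      by simp
    then show ?case
      by (intro exI [of _ "\<lambda>x. tr (s x, y x)"]) (simp add: y_def)
  qed
  from this [of n] obtain s where "continuous_on K s" "\<forall>x\<in>K. R (s x) (f (H (real n / real n, x)))"
    by blast
  with n H1 show ?thesis
    by (intro that [of s]) auto
qed

text \<open>Local transport is given by the principal logarithm of the quotient of two nearby
  values. The argument serves standard simplices as well, whose ambient type \<^typ>\<open>nat \<Rightarrow> real\<close>
  is a metric space but not a normed vector space.\<close>
lemma continuous_log_on_contracting:
  fixes u :: "'k::metric_space \<Rightarrow> complex"
  assumes K: "contracts_to K x0" and u: "continuous_on K u" and nz: "\<And>x. x \<in> K \<Longrightarrow> u x \<noteq> 0"
  obtains l where "continuous_on K l" "\<And>x. x \<in> K \<Longrightarrow> u x = exp (l x)"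
proof -
  have "compact (u ` K)" "0 \<notin> u ` K" "u ` K \<noteq> {}"
    using K nz by (auto simp: contracts_to_def intro: compact_continuous_image [OF u])
  then obtain \<delta> where "\<delta> > 0" and \<delta>: "\<And>y. y \<in> u ` K \<Longrightarrow> \<delta> \<le> norm y"
    using separate_point_closed [OF compact_imp_closed, of "u ` K" 0] by (metis dist_0_norm)
  \<comment> \<open>Nearby values have a quotient off the branch cut of the principal logarithm.\<close>
  have near: "y / exp e \<notin> \<real>\<^sub>\<le>\<^sub>0" if "exp e \<in> u ` K" "dist (exp e) y < \<delta>" for e y
  proof
    assume neg: "y / exp e \<in> \<real>\<^sub>\<le>\<^sub>0"
    have "norm (1 - y / exp e) * norm (exp e) = norm (exp e - y)"
      unfolding norm_mult [symmetric] by (simp add: algebra_simps)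
    also have "\<dots> < norm (exp e)"
      using that \<delta> [of "exp e"] by (simp add: dist_norm)
    finally have "norm (1 - y / exp e) < 1" by simp
    then have "\<bar>Re (1 - y / exp e)\<bar> < 1"
      using abs_Re_le_cmod order_le_less_trans by blast
    with neg show False
      by (auto simp: complex_nonpos_Reals_iff)
  qed
  define R where "R = (\<lambda>l y. exp l = (y::complex))"
  have "exp (Ln (u x0)) = u x0"
    using K nz by (simp add: contracts_to_def)
  moreover have "continuous_on {(e, y). y \<in> u ` K \<and> (\<exists>y' \<in> u ` K. R e y' \<and> dist y' y < \<delta>)}
      (\<lambda>(e, y). e + Ln (y / exp e))"
    unfolding split_beta
  proof (intro continuous_intros ballI)
    fix z assume "z \<in> {z. snd z \<in> u ` K \<and> (\<exists>y'\<in>u ` K. R (fst z) y' \<and> dist y' (snd z) < \<delta>)}"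
    then show "snd z / exp (fst z) \<notin> \<real>\<^sub>\<le>\<^sub>0"
      using near by (auto simp: R_def)
  qed auto
  moreover have "R ((\<lambda>(e, y). e + Ln (y / exp e)) (e, y)) y"
    if "R e y'" "y \<in> u ` K" "y' \<in> u ` K" "dist y' y < \<delta>" for e y y'
    using that nz by (auto simp: R_def exp_add)
  moreover have "R (Ln (u x0)) (u x0)"
    using calculation(1) by (simp add: R_def)
  ultimately obtain l where "continuous_on K l" "\<And>x. x \<in> K \<Longrightarrow> R (l x) (u x)"
    using lift_by_local_transport [OF K u \<open>\<delta> > 0\<close>, of R "\<lambda>(e, y). e + Ln (y / exp e)" "Ln (u x0)"]
    by blast
  then show thesis
    by (metis R_def that)
qed

lemma contracts_to_starlike:
  fixes K :: "'a::real_normed_vector set"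
  assumes "compact K" "x0 \<in> K" and seg: "\<And>x. x \<in> K \<Longrightarrow> closed_segment x0 x \<subseteq> K"
  shows "contracts_to K x0"
proof -
  define H where "H = (\<lambda>z::real \<times> 'a. (1 - fst z) *\<^sub>R x0 + fst z *\<^sub>R snd z)"
  have "continuous_on ({0..1} \<times> K) H"
    unfolding H_def by (intro continuous_intros)
  moreover have "H ` ({0..1} \<times> K) \<subseteq> K"
  proof clarify
    fix t :: real and x assume "t \<in> {0..1}" "x \<in> K"
    then have "H (t, x) \<in> closed_segment x0 x"
      by (auto simp: H_def in_segment)
    with seg \<open>x \<in> K\<close> show "H (t, x) \<in> K" by blast
  qed
  ultimately show ?thesis
    using assms(1,2) unfolding contracts_to_def by (intro conjI exI [of _ H]) (auto simp: H_def)
qed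

lemma contracts_to_standard_simplex: "contracts_to (standard_simplex p) (\<lambda>i. if i = 0 then 1 else 0)"
proof -
  let ?o = "\<lambda>i::nat. if i = 0 then 1 else 0 :: real"
  define H where "H = (\<lambda>z::real \<times> (nat \<Rightarrow> real). \<lambda>i. (1 - fst z) * ?o i + fst z * snd z i)"
  have "continuous_on ({0..1} \<times> standard_simplex p) H"
  proof (rule continuous_on_coordinatewise_then_product)
    fix i
    have "continuous_on ({0..1} \<times> standard_simplex p) (\<lambda>z. snd z i)"
      by (rule continuous_on_compose2 [OF continuous_on_product_coordinates [of i]])
         (intro continuous_on_snd continuous_on_id, simp)
    then show "continuous_on ({0..1} \<times> standard_simplex p) (\<lambda>z. H z i)"
      unfolding H_def by (intro continuous_intros)
  qed
  moreover have "H ` ({0..1} \<times> standard_simplex p) \<subseteq> standard_simplex p"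
    using convex_standard_simplex [of ?o p] by (auto simp: H_def)
  moreover have "compact (standard_simplex p)"
    using compactin_standard_simplex [of p] by (metis compactin_euclidean_iff euclidean_product_topology)
  ultimately show ?thesis
    unfolding contracts_to_def by (intro conjI exI [of _ H]) (auto simp: H_def)
qed

section \<open>The Hopf map\<close>

text \<open>The Hopf map from the nonzero vectors of \<open>\<complex>\<^sup>2\<close>, with the equatorial coordinates of
  the sphere collected in one complex number. It is used on all of \<open>\<complex>\<^sup>2 - {0}\<close>, not only
  on unit vectors: its fibres are then orbits of the nonzero complex numbers, and lifts
  need no normalisation.\<close>
definition hopf_coord :: "complex \<times> complex \<Rightarrow> complex \<times> real"
  where "hopf_coord v = (2 * fst v * cnj (snd v) / of_real ((norm v)\<^sup>2),
    ((cmod (fst v))\<^sup>2 - (cmod (snd v))\<^sup>2) / (norm v)\<^sup>2)"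

definition sphere_coord :: "(nat \<Rightarrow> real) \<Rightarrow> complex \<times> real"
  where "sphere_coord x = (Complex (x 0) (x 1), x 2)"

definition sphere_point :: "complex \<times> real \<Rightarrow> nat \<Rightarrow> real"
  where "sphere_point y = (\<lambda>i. if i = 0 then Re (fst y) else if i = 1 then Im (fst y)
    else if i = 2 then snd y else 0)"

definition hopf :: "complex \<times> complex \<Rightarrow> nat \<Rightarrow> real"
  where "hopf v = sphere_point (hopf_coord v)"

lemma norm_pair_squared: "(norm v)\<^sup>2 = (norm (fst v))\<^sup>2 + (norm (snd v))\<^sup>2"
  by (simp add: norm_prod_def)

lemma topspace_nsphere_2:
  "topspace (nsphere 2) = {x. (x 0)\<^sup>2 + (x 1)\<^sup>2 + (x 2)\<^sup>2 = 1 \<and> (\<forall>i>2. x i = 0)}"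
  by (auto simp: nsphere numeral_2_eq_2)

lemma sphere_point_coord: "x \<in> topspace (nsphere 2) \<Longrightarrow> sphere_point (sphere_coord x) = x"
  by (auto simp: sphere_point_def sphere_coord_def topspace_nsphere_2)

lemma sphere_coord_point [simp]: "sphere_coord (sphere_point y) = y"
  by (simp add: sphere_point_def sphere_coord_def complex_eq_iff prod_eq_iff)

lemma norm_sphere_coord: "x \<in> topspace (nsphere 2) \<Longrightarrow> norm (sphere_coord x) = 1"
  by (simp add: sphere_coord_def topspace_nsphere_2 norm_prod_def cmod_power2)

lemma sphere_point_in_nsphere: "norm y = 1 \<Longrightarrow> sphere_point y \<in> topspace (nsphere 2)"
  by (auto simp: sphere_point_def topspace_nsphere_2 norm_prod_def cmod_power2)

lemma continuous_on_sphere_coord: "continuous_on UNIV sphere_coord"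
proof -
  have "sphere_coord = (\<lambda>x. (of_real (x 0) + \<i> * of_real (x 1), x 2))"
    by (simp add: sphere_coord_def fun_eq_iff complex_eq_iff)
  moreover have "continuous_on UNIV (\<lambda>x::nat \<Rightarrow> real. (complex_of_real (x 0) + \<i> * of_real (x 1), x 2))"
    by (intro continuous_intros continuous_on_product_coordinates)
  ultimately show ?thesis by metis
qed

lemma norm_pair_eq_1:
  assumes "norm (w :: complex, t :: real) = 1"
  shows "w * cnj w = 1 - of_real t * of_real t"
proof -
  have "(cmod w)\<^sup>2 = 1 - t * t"
    using assms norm_pair_squared [of "(w, t)"] by (simp add: power2_eq_square)
  then show ?thesis
    by (metis complex_norm_square of_real_1 of_real_diff of_real_mult)
qed

text \<open>The fibre over \<open>(w, t)\<close> is the eigenspace for the eigenvalue 2 of the Hermitian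
  matrix with rows \<open>(1 + t, w)\<close> and \<open>(cnj w, 1 - t)\<close>, without its zero vector. In this
  form the fibre is a complex line and projections onto it can be written down.\<close>
lemma hopf_coord_iff:
  assumes v: "v \<noteq> 0" and y: "norm (w, t) = 1"
  shows "hopf_coord v = (w, t) \<longleftrightarrow>
    (1 - of_real t) * fst v = w * snd v \<and> (1 + of_real t) * snd v = cnj w * fst v"
proof -
  obtain a b where ab: "v = (a, b)" by force
  define N where "N = (norm v)\<^sup>2"
  have "N \<noteq> 0" using v by (simp add: N_def)
  have N: "N = (cmod a)\<^sup>2 + (cmod b)\<^sup>2" by (simp add: N_def ab norm_pair_squared)
  have aa: "of_real ((cmod a)\<^sup>2) = a * cnj a" and bb: "of_real ((cmod b)\<^sup>2) = b * cnj b"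
    by (simp_all add: complex_norm_square del: of_real_power)
  have cN: "of_real N = a * cnj a + b * cnj b" by (simp only: N aa bb of_real_add)
  have *: "hopf_coord v = (w, t) \<longleftrightarrow> 2 * a * cnj b = w * of_real N \<and> (cmod a)\<^sup>2 - (cmod b)\<^sup>2 = t * N"
    using \<open>N \<noteq> 0\<close> by (auto simp: hopf_coord_def ab N_def [symmetric, unfolded ab] field_simps)
  show ?thesis
  proof
    assume "hopf_coord v = (w, t)"
    then have w: "2 * a * cnj b = w * of_real N" and "(cmod a)\<^sup>2 - (cmod b)\<^sup>2 = t * N"
      using * by auto
    then have "of_real ((cmod a)\<^sup>2 - (cmod b)\<^sup>2) = (of_real (t * N) :: complex)"
      by simp
    then have t: "a * cnj a - b * cnj b = of_real t * of_real N"
      by (simp only: of_real_diff of_real_mult aa bb)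
    have cw: "2 * cnj a * b = cnj w * of_real N"
      using arg_cong [OF w, of cnj] by simp
    have "of_real N * ((1 - of_real t) * a) = of_real N * (w * b)"
    proof -
      have "of_real N * ((1 - of_real t) * a) = of_real N * a - (of_real t * of_real N) * a"
        by (simp add: algebra_simps)
      also have "\<dots> = (a * cnj a + b * cnj b) * a - (a * cnj a - b * cnj b) * a"
        by (simp only: t cN)
      also have "\<dots> = (2 * a * cnj b) * b"
        by (simp add: algebra_simps)
      also have "\<dots> = of_real N * (w * b)"
        unfolding w by (simp add: mult_ac)
      finally show ?thesis .
    qed
    moreover have "of_real N * ((1 + of_real t) * b) = of_real N * (cnj w * a)"
    proof -
      have "of_real N * ((1 + of_real t) * b) = of_real N * b + (of_real t * of_real N) * b"
        by (simp add: algebra_simps)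
      also have "\<dots> = (a * cnj a + b * cnj b) * b + (a * cnj a - b * cnj b) * b"
        by (simp only: t cN)
      also have "\<dots> = (2 * cnj a * b) * a"
        by (simp add: algebra_simps)
      also have "\<dots> = of_real N * (cnj w * a)"
        unfolding cw by (simp add: mult_ac)
      finally show ?thesis .
    qed
    ultimately show "(1 - of_real t) * fst v = w * snd v \<and> (1 + of_real t) * snd v = cnj w * fst v"
      using \<open>N \<noteq> 0\<close> by (simp add: ab)
  next
    assume "(1 - of_real t) * fst v = w * snd v \<and> (1 + of_real t) * snd v = cnj w * fst v"
    then have 1: "(1 - of_real t) * a = w * b" and 2: "(1 + of_real t) * b = cnj w * a"
      by (auto simp: ab)
    have 3: "(1 + of_real t) * cnj b = w * cnj a"
      using arg_cong [OF 2, of cnj] by simp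
    have "w * of_real N = (w * cnj a) * a + (w * b) * cnj b"
      by (simp add: cN algebra_simps)
    also have "\<dots> = 2 * a * cnj b"
      unfolding 1 [symmetric] 3 [symmetric] by (simp add: algebra_simps)
    finally have w: "2 * a * cnj b = w * of_real N" ..
    have "of_real ((cmod a)\<^sup>2 - (cmod b)\<^sup>2) = (of_real (t * N) :: complex)"
    proof -
      have "(a * cnj a - b * cnj b) - of_real t * (a * cnj a + b * cnj b)
          = ((1 - of_real t) * a) * cnj a - ((1 + of_real t) * cnj b) * b"
        by (simp add: algebra_simps)
      also have "\<dots> = 0"
        unfolding 1 3 by (simp add: algebra_simps)
      finally show ?thesis
        unfolding of_real_diff of_real_mult aa bb cN by (simp only: right_minus_eq)
    qed
    then have "(cmod a)\<^sup>2 - (cmod b)\<^sup>2 = t * N"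
      using of_real_eq_iff by blast
    with w * show "hopf_coord v = (w, t)" by blast
  qed
qed

lemma norm_hopf_coord: 
  assumes "v \<noteq> 0" shows "norm (hopf_coord v) = 1"
proof -
  obtain a b where ab: "v = (a, b)" by force
  define N where "N = (norm v)\<^sup>2"
  have "N \<noteq> 0" using assms by (simp add: N_def)
  have N: "N = (cmod a)\<^sup>2 + (cmod b)\<^sup>2" by (simp add: N_def ab norm_pair_squared)
  have "(norm (hopf_coord v))\<^sup>2 = (2 * cmod a * cmod b / N)\<^sup>2 + (((cmod a)\<^sup>2 - (cmod b)\<^sup>2) / N)\<^sup>2"
    using norm_pair_squared [of "hopf_coord v"]
    by (simp add: hopf_coord_def N_def norm_mult norm_divide norm_power power_divide ab)
  also have "\<dots> = 1"
    using \<open>N \<noteq> 0\<close> by (simp add: divide_simps) (simp add: N power2_eq_square algebra_simps)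
  finally show ?thesis
    using power2_eq_1_iff [of "norm (hopf_coord v)"] norm_ge_zero [of "hopf_coord v"] by linarith
qed

lemma hopf_in_nsphere: "v \<noteq> 0 \<Longrightarrow> hopf v \<in> topspace (nsphere 2)"
  by (simp add: hopf_def sphere_point_in_nsphere norm_hopf_coord)

lemma hopf_eq_iff: "x \<in> topspace (nsphere 2) \<Longrightarrow> hopf v = x \<longleftrightarrow> hopf_coord v = sphere_coord x"
  by (metis hopf_def sphere_coord_point sphere_point_coord)

lemma continuous_on_hopf: "continuous_on (- {0}) hopf"
proof -
  have "continuous_on (- {0}) hopf_coord"
    unfolding hopf_coord_def by (intro continuous_intros) auto
  then have "continuous_on (-{0}) (\<lambda>v. sphere_point (hopf_coord v) i)" for i
    unfolding sphere_point_def
    by (cases "i = 0"; cases "i = 1"; cases "i = 2"; simp; intro continuous_intros)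
  then show ?thesis
    unfolding hopf_def by (rule continuous_on_coordinatewise_then_product)
qed

lemma hopf_surj:
  assumes "x \<in> topspace (nsphere 2)"
  obtains v where "v \<noteq> 0" "hopf v = x"
proof -
  obtain w t where wt: "sphere_coord x = (w, t)" by force
  with norm_sphere_coord [OF assms] have n: "norm (w, t) = 1" by simp
  note ww = norm_pair_eq_1 [OF n]
  show ?thesis
  proof (cases "t = -1")
    case True
    with ww have "w = 0" by simp
    with True show ?thesis
      using that [of "(0, 1)"] assms wt by (simp add: hopf_eq_iff hopf_coord_def norm_prod_def zero_prod_def)
  next
    case False
    then have "1 + of_real t \<noteq> (0::complex)"
      by (metis add.inverse_inverse add_eq_0_iff of_real_1 of_real_eq_iff of_real_minus)
    moreover have "(1 - of_real t) * (1 + of_real t) = w * cnj w"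
      by (simp add: ww algebra_simps)
    \<comment> \<open>The witness is the first column of the matrix of the fibre equations; it vanishes only at the south pole.\<close>
    ultimately show ?thesis
      using that [of "(1 + of_real t, cnj w)"] assms
      by (simp add: hopf_eq_iff wt hopf_coord_iff n zero_prod_def mult.commute)
  qed
qed

text \<open>The local transport moves a vector \<open>v\<close> over \<open>y'\<close> to its orthogonal projection, up to
  a factor of 2, onto the line belonging to \<open>y\<close>. The projection vanishes only if \<open>y\<close> is
  antipodal to \<open>y'\<close>, that is, at distance 2.\<close>
lemma hopf_lift:
  fixes f :: "'k::metric_space \<Rightarrow> nat \<Rightarrow> real"
  assumes K: "contracts_to K x0" and f: "continuous_on K f" and fim: "f \<in> K \<rightarrow> topspace (nsphere 2)"
  obtains s where "continuous_on K s" "\<And>x. x \<in> K \<Longrightarrow> s x \<noteq> 0 \<and> hopf (s x) = f x"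
proof -
  define g where "g = sphere_coord \<circ> f"
  have g: "continuous_on K g"
    unfolding g_def using continuous_on_sphere_coord continuous_on_subset f
    by (blast intro: continuous_on_compose)
  have ng: "norm (g x) = 1" if "x \<in> K" for x
    using that fim norm_sphere_coord by (auto simp: g_def)
  define R where "R = (\<lambda>v y. v \<noteq> 0 \<and> hopf_coord v = y)"
  define tr where "tr = (\<lambda>((a, b), (w, t)). ((1 + of_real t) * a + w * b, cnj w * a + (1 - of_real t) * b))"
  have "x0 \<in> K" using K by (simp add: contracts_to_def)
  then obtain v0 where v0: "R v0 (g x0)"
    using hopf_surj [of "f x0"] fim hopf_eq_iff [of "f x0"] unfolding R_def g_def comp_def
    by (metis funcset_mem)
  have ctr: "continuous_on A tr" for A
    unfolding tr_def split_beta by (intro continuous_intros)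
  have Rtr: "R (tr (v, y)) y" if "R v y'" "y \<in> g ` K" "y' \<in> g ` K" "dist y' y < 1" for v y y'
  proof -
    obtain w t where wt: "y = (w, t)" by force
    obtain a b where ab: "v = (a, b)" by force
    have n: "norm (w, t) = 1" using that ng wt by auto
    note ww = norm_pair_eq_1 [OF n]
    have nz: "tr (v, y) \<noteq> 0"
    proof
      assume "tr (v, y) = 0"
      \<comment> \<open>Then \<open>v\<close> satisfies the equations of the fibre over the antipode of \<open>y\<close>.\<close>
      then have "(1 + of_real t) * a = - w * b" "(1 - of_real t) * b = - cnj w * a"
        by (auto simp: tr_def wt ab zero_prod_def add_eq_0_iff)
      moreover have "norm (-w, -t) = 1" using n by (simp add: norm_prod_def)
      ultimately have "hopf_coord v = (-w, -t)"
        using hopf_coord_iff [of v "-w" "-t"] that by (simp add: R_def ab)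
      then have "y' = - y" using that by (simp add: R_def wt)
      then have "dist y' y = norm (2 *\<^sub>R y)"
        by (simp add: dist_norm scaleR_2 norm_minus_commute)
      also have "\<dots> = 2"
        using n by (simp add: wt del: scaleR_Pair)
      finally show False using that by simp
    qed
    have "(1 - of_real t) * ((1 + of_real t) * a + w * b) = w * (cnj w * a + (1 - of_real t) * b)"
      "(1 + of_real t) * (cnj w * a + (1 - of_real t) * b) = cnj w * ((1 + of_real t) * a + w * b)"
    proof -
      have "(1 - of_real t) * ((1 + of_real t) * a + w * b)
          = (1 - of_real t * of_real t) * a + (1 - of_real t) * w * b"
        by (simp add: algebra_simps)
      also have "\<dots> = w * (cnj w * a + (1 - of_real t) * b)"
        unfolding ww [symmetric] by (simp add: algebra_simps)
      finally show "(1 - of_real t) * ((1 + of_real t) * a + w * b) = w * (cnj w * a + (1 - of_real t) * b)" .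
      have "(1 + of_real t) * (cnj w * a + (1 - of_real t) * b)
          = (1 - of_real t * of_real t) * b + (1 + of_real t) * cnj w * a"
        by (simp add: algebra_simps)
      also have "\<dots> = cnj w * ((1 + of_real t) * a + w * b)"
        unfolding ww [symmetric] by (simp add: algebra_simps)
      finally show "(1 + of_real t) * (cnj w * a + (1 - of_real t) * b) = cnj w * ((1 + of_real t) * a + w * b)" .
    qed
    then show ?thesis
      using nz hopf_coord_iff [OF nz n] by (simp add: R_def wt ab tr_def)
  qed
  obtain s where s: "continuous_on K s" "\<And>x. x \<in> K \<Longrightarrow> R (s x) (g x)"
  proof (rule lift_by_local_transport [where R = R and tr = tr, OF K g zero_less_one ctr _ v0])
    show "R (tr (v, y)) y" if "R v y'" "y \<in> g ` K" "y' \<in> g ` K" "dist y' y < 1" for v y y'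
      by (rule Rtr [OF that])
  qed blast
  show thesis
  proof
    show "continuous_on K s" by fact
    show "s x \<noteq> 0 \<and> hopf (s x) = f x" if "x \<in> K" for x
      using s(2) [OF that] fim that hopf_eq_iff [of "f x" "s x"] by (auto simp: R_def g_def)
  qed
qed

definition cscale :: "complex \<Rightarrow> complex \<times> complex \<Rightarrow> complex \<times> complex"
  where "cscale c v = (c * fst v, c * snd v)"

lemma cscale_cscale [simp]: "cscale c (cscale d v) = cscale (c * d) v"
  and cscale_eq_0_iff [simp]: "cscale c v = 0 \<longleftrightarrow> c = 0 \<or> v = 0"
  by (auto simp: cscale_def prod_eq_iff mult.assoc)

lemma cscale_cancel: "v \<noteq> 0 \<Longrightarrow> cscale c v = cscale d v \<longleftrightarrow> c = d"
  by (auto simp: cscale_def prod_eq_iff)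

lemma hopf_cscale:
  assumes "c \<noteq> 0" shows "hopf (cscale c v) = hopf v"
proof -
  have "(norm (cscale c v))\<^sup>2 = (cmod c)\<^sup>2 * (norm v)\<^sup>2"
    by (simp add: cscale_def norm_pair_squared norm_mult power_mult_distrib algebra_simps)
  moreover have "2 * (c * fst v) * cnj (c * snd v) = of_real ((cmod c)\<^sup>2) * (2 * fst v * cnj (snd v))"
    by (simp only: complex_norm_square) simp
  moreover have "(cmod (c * fst v))\<^sup>2 - (cmod (c * snd v))\<^sup>2 = (cmod c)\<^sup>2 * ((cmod (fst v))\<^sup>2 - (cmod (snd v))\<^sup>2)"
    by (simp add: norm_mult power_mult_distrib algebra_simps)
  moreover have "(cmod c)\<^sup>2 \<noteq> 0" using assms by simp
  ultimately have "hopf_coord (cscale c v) = hopf_coord v"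
    unfolding hopf_coord_def
    by (simp only: cscale_def fst_conv snd_conv of_real_mult) (simp del: of_real_power)
  then show ?thesis by (simp add: hopf_def)
qed

text \<open>Points over the same point of the sphere span the same complex line, by the linear
  equations for the fibre. The Hermitian inner product then gives a factor that depends
  continuously on both points.\<close>
lemma hopf_fibre_ratio:
  assumes "v \<noteq> 0" "v' \<noteq> 0" "hopf v = hopf v'"
  shows "v = cscale ((fst v * cnj (fst v') + snd v * cnj (snd v')) / of_real ((norm v')\<^sup>2)) v'"
proof -
  obtain a b where ab: "v = (a, b)" by force
  obtain a' b' where ab': "v' = (a', b')" by force
  obtain w t where wt: "hopf_coord v = (w, t)" by force
  then have n: "norm (w, t) = 1" using norm_hopf_coord [OF assms(1)] by simp
  have "hopf_coord v' = (w, t)"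
    using assms(3) wt by (metis hopf_def sphere_coord_point)
  with wt have 1: "(1 - of_real t) * a = w * b" "(1 + of_real t) * b = cnj w * a"
    and 2: "(1 - of_real t) * a' = w * b'" "(1 + of_real t) * b' = cnj w * a'"
    using hopf_coord_iff [OF assms(1) n] hopf_coord_iff [OF assms(2) n] by (auto simp: ab ab')
  have "(1 - of_real t) * (a * b' - a' * b) = 0" "(1 + of_real t) * (a * b' - a' * b) = 0"
  proof -
    have "(1 - of_real t) * (a * b' - a' * b) = ((1 - of_real t) * a) * b' - ((1 - of_real t) * a') * b"
      by (simp add: algebra_simps)
    then show "(1 - of_real t) * (a * b' - a' * b) = 0"
      unfolding 1 2 by (simp add: algebra_simps)
    have "(1 + of_real t) * (a * b' - a' * b) = a * ((1 + of_real t) * b') - a' * ((1 + of_real t) * b)"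
      by (simp add: algebra_simps)
    then show "(1 + of_real t) * (a * b' - a' * b) = 0"
      unfolding 1 2 by (simp add: algebra_simps)
  qed
  then have "(1 - of_real t) * (a * b' - a' * b) + (1 + of_real t) * (a * b' - a' * b) = 0"
    by (simp only: add_0)
  then have "2 * (a * b' - a' * b) = 0"
    by (simp add: algebra_simps)
  then have eq: "a * b' = a' * b" by simp
  have N: "of_real ((norm v')\<^sup>2) = a' * cnj a' + b' * cnj b'"
    by (simp only: norm_pair_squared ab' fst_conv snd_conv of_real_add complex_norm_square)
  have "(norm v')\<^sup>2 \<noteq> 0" using assms(2) by simp
  then have "a' * cnj a' + b' * cnj b' \<noteq> 0"
    using N by (metis of_real_eq_0_iff)
  moreover have "(a * cnj a' + b * cnj b') * a' = a * (a' * cnj a' + b' * cnj b')"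
    "(a * cnj a' + b * cnj b') * b' = b * (a' * cnj a' + b' * cnj b')"
  proof -
    have "(a * cnj a' + b * cnj b') * a' = a * a' * cnj a' + (a' * b) * cnj b'"
      by (simp add: algebra_simps)
    then show "(a * cnj a' + b * cnj b') * a' = a * (a' * cnj a' + b' * cnj b')"
      unfolding eq [symmetric] by (simp add: algebra_simps)
    have "(a * cnj a' + b * cnj b') * b' = (a * b') * cnj a' + b * b' * cnj b'"
      by (simp add: algebra_simps)
    then show "(a * cnj a' + b * cnj b') * b' = b * (a' * cnj a' + b' * cnj b')"
      unfolding eq by (simp add: algebra_simps)
  qed
  ultimately show ?thesis
    unfolding N by (auto simp: ab ab' cscale_def field_simps eq)
qed

text \<open>The factor relating two lifts is a continuous nowhere zero function, so it has a
  logarithm on a contractible domain.\<close>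
lemma hopf_lifts_differ_by_exp:
  fixes s s' :: "'k::metric_space \<Rightarrow> complex \<times> complex"
  assumes K: "contracts_to K x0" and s: "continuous_on K s" and s': "continuous_on K s'"
    and nz: "\<And>x. x \<in> K \<Longrightarrow> s x \<noteq> 0" "\<And>x. x \<in> K \<Longrightarrow> s' x \<noteq> 0"
    and eq: "\<And>x. x \<in> K \<Longrightarrow> hopf (s x) = hopf (s' x)"
  obtains l where "continuous_on K l" "\<And>x. x \<in> K \<Longrightarrow> s x = cscale (exp (l x)) (s' x)"
proof -
  define u where "u = (\<lambda>x. (fst (s x) * cnj (fst (s' x)) + snd (s x) * cnj (snd (s' x))) / of_real ((norm (s' x))\<^sup>2))"
  have us: "s x = cscale (u x) (s' x)" if "x \<in> K" for x
    unfolding u_def by (rule hopf_fibre_ratio) (use nz eq that in auto)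
  have "continuous_on K u"
    unfolding u_def by (intro continuous_intros s s') (use nz in auto)
  moreover have "u x \<noteq> 0" if "x \<in> K" for x
    using us [OF that] nz(1) [OF that] by auto
  ultimately obtain l where "continuous_on K l" "\<And>x. x \<in> K \<Longrightarrow> u x = exp (l x)"
    using continuous_log_on_contracting [OF K] by blast
  with us that show thesis by metis
qed

section \<open>Comparing lifts of a path\<close>

text \<open>If \<open>s = exp \<circ> l\<close> times \<open>s'\<close> on the unit interval, this is the total change \<open>l 1 - l
  0\<close>. For a closed factor \<open>exp \<circ> l\<close> it is \<open>2\<pi>\<i>\<close> times the winding number.\<close>
definition log_change :: "(real \<Rightarrow> complex \<times> complex) \<Rightarrow> (real \<Rightarrow> complex \<times> complex) \<Rightarrow> complex"
  where "log_change s s' = (SOME v. \<exists>l. continuous_on {0..1} l \<and>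
    (\<forall>t\<in>{0..1}. s t = cscale (exp (l t)) (s' t)) \<and> v = l 1 - l 0)"

text \<open>Independence of the chosen logarithm: two of them differ by a continuous function
  with values in \<open>2\<pi>\<i>\<int>\<close>, which is constant on an interval.\<close>
lemma log_change_eq:
  assumes l: "continuous_on {0..1} l" and nz: "\<And>t. t \<in> {0..1} \<Longrightarrow> s' t \<noteq> 0"
    and eq: "\<And>t. t \<in> {0..1} \<Longrightarrow> s t = cscale (exp (l t)) (s' t)"
  shows "log_change s s' = l 1 - l 0"
  unfolding log_change_def
proof (rule some_equality)
  show "\<exists>l'. continuous_on {0..1} l' \<and> (\<forall>t\<in>{0..1}. s t = cscale (exp (l' t)) (s' t)) \<and> l 1 - l 0 = l' 1 - l' 0"
    using l eq by blast
next
  fix v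
  assume "\<exists>l. continuous_on {0..1} l \<and> (\<forall>t\<in>{0..1}. s t = cscale (exp (l t)) (s' t)) \<and> v = l 1 - l 0"
  then obtain m where m: "continuous_on {0..1} m" "\<And>t. t \<in> {0..1} \<Longrightarrow> s t = cscale (exp (m t)) (s' t)"
    and v: "v = m 1 - m 0" by auto
  have e: "exp (m t - l t) = 1" if t: "t \<in> {0..1}" for t
  proof -
    have "exp (m t) = exp (l t)"
      using m(2) [OF t] eq [OF t] nz [OF t] cscale_cancel by metis
    then show ?thesis by (simp add: exp_diff)
  qed
  have "(\<lambda>t. m t - l t) constant_on {0..1}"
  proof (rule continuous_discrete_range_constant)
    fix t :: real assume t: "t \<in> {0..1}"
    have "2 * pi \<le> norm ((m u - l u) - (m t - l t))"
      if u: "u \<in> {0..1}" "m u - l u \<noteq> m t - l t" for u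
    proof -
      have "exp ((m u - l u) - (m t - l t)) = 1"
        using e [OF t] e [OF u(1)] by (simp add: exp_diff)
      then obtain n :: int where n: "(m u - l u) - (m t - l t) = of_int (2 * n) * of_real pi * \<i>"
        using exp_eq_1 by (auto simp: complex_eq_iff)
      with u have "n \<noteq> 0" by auto
      then have "1 \<le> \<bar>real_of_int n\<bar>" by linarith
      then show ?thesis
        using n pi_gt_zero by (simp add: norm_mult)
    qed
    then show "\<exists>e>0. \<forall>y. y \<in> {0..1} \<and> m y - l y \<noteq> m t - l t \<longrightarrow> e \<le> norm (m y - l y - (m t - l t))"
      by (intro exI [of _ "2 * pi"]) simp
  next
    show "continuous_on {0..1} (\<lambda>t. m t - l t)"
      by (intro continuous_on_diff m l)
  qed simp
  then obtain c where "\<And>t. t \<in> {0..1} \<Longrightarrow> m t - l t = c"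
    unfolding constant_on_def by blast
  from this [of 0] this [of 1] show "v = l 1 - l 0"
    by (simp add: v algebra_simps)
qed

definition path_lift :: "(real \<Rightarrow> complex \<times> complex) \<Rightarrow> (real \<Rightarrow> nat \<Rightarrow> real) \<Rightarrow> bool"
  where "path_lift s \<gamma> \<longleftrightarrow> continuous_on {0..1} s \<and> (\<forall>t\<in>{0..1}. s t \<noteq> 0 \<and> hopf (s t) = \<gamma> t)"

lemma contracts_to_unit_interval: "contracts_to {0..1::real} 0"
  by (rule contracts_to_starlike) (auto simp: closed_segment_eq_real_ivl)

lemma path_lifts_log:
  assumes "path_lift s \<gamma>" "path_lift s' \<gamma>"
  obtains l where "continuous_on {0..1} l" "\<And>t. t \<in> {0..1} \<Longrightarrow> s t = cscale (exp (l t)) (s' t)"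
proof (rule hopf_lifts_differ_by_exp [OF contracts_to_unit_interval, of s s'])
  fix l assume "continuous_on {0..1} l" "\<And>t. t \<in> {0..1} \<Longrightarrow> s t = cscale (exp (l t)) (s' t)"
  then show thesis by (rule that)
qed (use assms in \<open>auto simp: path_lift_def\<close>)

lemma log_change_trans:
  assumes "path_lift s \<gamma>" "path_lift s' \<gamma>" "path_lift s'' \<gamma>"
  shows "log_change s s'' = log_change s s' + log_change s' s''"
proof -
  obtain l where l: "continuous_on {0..1} l" "\<And>t. t \<in> {0..1} \<Longrightarrow> s t = cscale (exp (l t)) (s' t)"
    using path_lifts_log assms by blast
  obtain l' where l': "continuous_on {0..1} l'" "\<And>t. t \<in> {0..1} \<Longrightarrow> s' t = cscale (exp (l' t)) (s'' t)"
    using path_lifts_log assms by blast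
  have nz: "s' t \<noteq> 0" "s'' t \<noteq> 0" if "t \<in> {0..1}" for t
    using assms that by (auto simp: path_lift_def)
  have "log_change s s'' = (l 1 + l' 1) - (l 0 + l' 0)"
    by (intro log_change_eq [where l = "\<lambda>t. l t + l' t"] continuous_on_add l l' nz) (simp_all add: l l' exp_add)
  moreover have "log_change s s' = l 1 - l 0" "log_change s' s'' = l' 1 - l' 0"
    by (intro log_change_eq l l' nz; assumption)+
  ultimately show ?thesis by simp
qed

lemma log_change_const:
  assumes "\<And>t. t \<in> {0..1} \<Longrightarrow> s t = v" "\<And>t. t \<in> {0..1} \<Longrightarrow> s' t = v'" "v \<noteq> 0" "v' \<noteq> 0" "hopf v = hopf v'"
  shows "log_change s s' = 0"
proof -
  obtain c where c: "v = cscale c v'" using hopf_fibre_ratio assms by blast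
  then have "c \<noteq> 0" using assms by auto
  then show ?thesis
    using log_change_eq [of "\<lambda>t. Ln c" s' s] assms c by (simp add: exp_Ln)
qed

section \<open>The obstruction cochain of the 2-sphere\<close>

definition edge_point :: "real \<Rightarrow> nat \<Rightarrow> real"
  where "edge_point t = (\<lambda>i. if i = 0 then 1 - t else if i = 1 then t else 0)"

lemma edge_point_in: "t \<in> {0..1} \<Longrightarrow> edge_point t \<in> standard_simplex 1"
  by (auto simp: edge_point_def standard_simplex_def)

lemma continuous_on_edge_point: "continuous_on S edge_point"
  unfolding edge_point_def
  apply (rule continuous_on_coordinatewise_then_product)
  subgoal for i by (cases "i = 0"; cases "i = 1"; simp; intro continuous_intros)
  done

lemma continuous_on_simplical_face: "continuous_on S (simplical_face k :: (nat \<Rightarrow> real) \<Rightarrow> nat \<Rightarrow> real)"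
proof (rule continuous_on_coordinatewise_then_product)
  fix i
  have "continuous_on S (\<lambda>x. x j)" for j :: nat
    by (rule continuous_on_subset [OF continuous_on_product_coordinates subset_UNIV])
  then show "continuous_on S (\<lambda>x::nat \<Rightarrow> real. simplical_face k x i)"
    unfolding simplical_face_def by (cases "i < k"; cases "i = k"; simp)
qed

lemma singular_simplex_nsphere:
  assumes "singular_simplex p (nsphere n) \<sigma>"
  shows "continuous_on (standard_simplex p) \<sigma>" "\<sigma> \<in> standard_simplex p \<rightarrow> topspace (nsphere n)"
proof -
  have c: "continuous_map (subtopology (powertop_real UNIV) (standard_simplex p)) (nsphere n) \<sigma>"
    using assms by (simp add: singular_simplex_def)
  then show "\<sigma> \<in> standard_simplex p \<rightarrow> topspace (nsphere n)"
    by (auto simp: continuous_map_def)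
  have "continuous_map (top_of_set (standard_simplex p)) euclidean \<sigma>"
    using c by (simp add: nsphere continuous_map_in_subtopology euclidean_product_topology)
  then show "continuous_on (standard_simplex p) \<sigma>"
    by simp
qed

text \<open>One lift is fixed for every singular 1-simplex, so that the triangles sharing an
  edge are compared with the same lift over it. The extra demand makes constant edges
  invisible to the obstruction.\<close>
definition edge_lift :: "((nat \<Rightarrow> real) \<Rightarrow> nat \<Rightarrow> real) \<Rightarrow> real \<Rightarrow> complex \<times> complex"
  where "edge_lift \<tau> = (SOME s. path_lift s (\<tau> \<circ> edge_point) \<and>
    ((\<exists>y. \<forall>t\<in>{0..1}. \<tau> (edge_point t) = y) \<longrightarrow> (\<exists>v. \<forall>t\<in>{0..1}. s t = v)))"

lemma edge_lift:
  assumes \<tau>: "singular_simplex 1 (nsphere 2) \<tau>"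
  shows "path_lift (edge_lift \<tau>) (\<tau> \<circ> edge_point) \<and>
    ((\<exists>y. \<forall>t\<in>{0..1}. \<tau> (edge_point t) = y) \<longrightarrow> (\<exists>v. \<forall>t\<in>{0..1}. edge_lift \<tau> t = v))"
proof -
  note \<tau>' = singular_simplex_nsphere [OF \<tau>]
  have "\<exists>s. path_lift s (\<tau> \<circ> edge_point) \<and>
    ((\<exists>y. \<forall>t\<in>{0..1}. \<tau> (edge_point t) = y) \<longrightarrow> (\<exists>v. \<forall>t\<in>{0..1}. s t = v))"
  proof (cases "\<exists>y. \<forall>t\<in>{0..1}. \<tau> (edge_point t) = y")
    case True
    then obtain y where y: "\<And>t. t \<in> {0..1} \<Longrightarrow> \<tau> (edge_point t) = y" by blast
    have "edge_point 0 \<in> standard_simplex 1"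
      by (intro edge_point_in) simp
    then have "y \<in> topspace (nsphere 2)"
      using y [of 0] \<tau>'(2) by auto
    then obtain v where "v \<noteq> 0" "hopf v = y"
      using hopf_surj by blast
    then show ?thesis
      using y by (intro exI [of _ "\<lambda>t. v"]) (auto simp: path_lift_def)
  next
    case False
    have "continuous_on {0..1} (\<tau> \<circ> edge_point)"
      by (intro continuous_on_compose continuous_on_edge_point continuous_on_subset [OF \<tau>'(1)])
        (use edge_point_in in auto)
    moreover have "\<tau> \<circ> edge_point \<in> {0..1} \<rightarrow> topspace (nsphere 2)"
      using \<tau>'(2) edge_point_in by (auto simp: Pi_iff simp del: atLeastAtMost_iff One_nat_def)
    ultimately obtain s where "continuous_on {0..1} s" "\<And>t. t \<in> {0..1} \<Longrightarrow> s t \<noteq> 0 \<and> hopf (s t) = (\<tau> \<circ> edge_point) t"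
      by (rule hopf_lift [OF contracts_to_unit_interval]) blast
    then have "path_lift s (\<tau> \<circ> edge_point)"
      unfolding path_lift_def by blast
    with False show ?thesis
      by blast
  qed
  then show ?thesis
    unfolding edge_lift_def by (rule someI_ex)
qed

definition simplex_lift :: "nat \<Rightarrow> ((nat \<Rightarrow> real) \<Rightarrow> complex \<times> complex) \<Rightarrow> ((nat \<Rightarrow> real) \<Rightarrow> nat \<Rightarrow> real) \<Rightarrow> bool"
  where "simplex_lift p s \<sigma> \<longleftrightarrow> continuous_on (standard_simplex p) s \<and>
    (\<forall>x\<in>standard_simplex p. s x \<noteq> 0 \<and> hopf (s x) = \<sigma> x)"

lemma simplex_lift_exists:
  assumes "singular_simplex p (nsphere 2) \<sigma>"
  shows "\<exists>s. simplex_lift p s \<sigma>"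
proof (rule hopf_lift [OF contracts_to_standard_simplex singular_simplex_nsphere [OF assms]])
  fix s assume "continuous_on (standard_simplex p) s"
    "\<And>x. x \<in> standard_simplex p \<Longrightarrow> s x \<noteq> 0 \<and> hopf (s x) = \<sigma> x"
  then show ?thesis unfolding simplex_lift_def by blast
qed

text \<open>The map \<open>m\<close> embeds the standard 1-simplex as an edge of the domain of \<open>\<sigma>\<close>. Keeping
  \<open>m\<close> general allows edges of triangles and edges of 3-simplices to be treated alike.\<close>
definition edge_defect ::
  "((nat \<Rightarrow> real) \<Rightarrow> complex \<times> complex) \<Rightarrow> ((nat \<Rightarrow> real) \<Rightarrow> nat \<Rightarrow> real) \<Rightarrow>
    ((nat \<Rightarrow> real) \<Rightarrow> nat \<Rightarrow> real) \<Rightarrow> complex"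
  where "edge_defect s \<sigma> m =
    log_change (s \<circ> m \<circ> edge_point) (edge_lift (restrict (\<sigma> \<circ> m) (standard_simplex 1)))"

definition defect_sum ::
  "((nat \<Rightarrow> real) \<Rightarrow> complex \<times> complex) \<Rightarrow> ((nat \<Rightarrow> real) \<Rightarrow> nat \<Rightarrow> real) \<Rightarrow>
    ((nat \<Rightarrow> real) \<Rightarrow> nat \<Rightarrow> real) \<Rightarrow> complex"
  where "defect_sum s \<sigma> m = edge_defect s \<sigma> (m \<circ> simplical_face 0)
    - edge_defect s \<sigma> (m \<circ> simplical_face 1) + edge_defect s \<sigma> (m \<circ> simplical_face 2)"

text \<open>The chosen lifts over the three edges need not fit together at the vertices; this
  does no harm, because an edge defect only records how the logarithm of a factor changes
  along the edge. The sum of the edge defects is the obstruction to lifting the triangle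
  compatibly with the edges. On singular simplices of the 2-sphere it represents, up to
  sign, a coboundary and a factor \<open>2\<pi>\<i>\<close>, the Euler class of the Hopf bundle.\<close>
definition obstruction :: "((nat \<Rightarrow> real) \<Rightarrow> nat \<Rightarrow> real) \<Rightarrow> complex"
  where "obstruction \<sigma> = defect_sum (SOME s. simplex_lift 2 s \<sigma>) \<sigma> id"

lemma face_edge_in:
  assumes "k \<le> 2" "t \<in> {0..1}"
  shows "simplical_face k (edge_point t) \<in> standard_simplex 2"
  using simplical_face_in_standard_simplex [of 2 k "edge_point t"] edge_point_in [of t] assms by simp

lemma path_lift_face:
  assumes s: "simplex_lift 2 s \<sigma>" and "k \<le> 2"
  shows "path_lift (s \<circ> simplical_face k \<circ> edge_point) (\<sigma> \<circ> simplical_face k \<circ> edge_point)"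
proof -
  have "continuous_on {0..1} (s \<circ> simplical_face k \<circ> edge_point)"
  proof (intro continuous_on_compose continuous_on_edge_point continuous_on_simplical_face)
    show "continuous_on (simplical_face k ` edge_point ` {0..1}) s"
    proof (rule continuous_on_subset)
      show "continuous_on (standard_simplex 2) s"
        using s by (simp add: simplex_lift_def)
    qed (use face_edge_in [OF \<open>k \<le> 2\<close>] in blast)
  qed
  then show ?thesis
    using s face_edge_in [OF \<open>k \<le> 2\<close>] by (simp add: path_lift_def simplex_lift_def)
qed

lemma path_lift_face_edge:
  assumes \<sigma>: "singular_simplex 2 (nsphere 2) \<sigma>" and "k \<le> 2"
  shows "path_lift (edge_lift (restrict (\<sigma> \<circ> simplical_face k) (standard_simplex 1))) (\<sigma> \<circ> simplical_face k \<circ> edge_point)"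
proof -
  have "singular_simplex 1 (nsphere 2) (restrict (\<sigma> \<circ> simplical_face k) (standard_simplex 1))"
    using singular_simplex_singular_face [OF \<sigma> _ \<open>k \<le> 2\<close>] by (simp add: singular_face_def)
  from edge_lift [OF this] have "path_lift (edge_lift (restrict (\<sigma> \<circ> simplical_face k) (standard_simplex 1)))
      (restrict (\<sigma> \<circ> simplical_face k) (standard_simplex 1) \<circ> edge_point)" ..
  moreover have "(restrict (\<sigma> \<circ> simplical_face k) (standard_simplex 1) \<circ> edge_point) t = (\<sigma> \<circ> simplical_face k \<circ> edge_point) t"
    if "t \<in> {0..1}" for t
    using edge_point_in [OF that] by simp
  ultimately show ?thesis
    unfolding path_lift_def by simp
qed

text \<open>Two lifts over the whole triangle differ by a factor \<open>exp \<circ> l\<close> with \<open>l\<close> defined on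
  the whole triangle. The defect along an edge then changes by the difference of \<open>l\<close> at
  the end points of the edge, and these differences add up to zero around the triangle.\<close>
lemma obstruction_eq:
  assumes \<sigma>: "singular_simplex 2 (nsphere 2) \<sigma>" and s: "simplex_lift 2 s \<sigma>"
  shows "obstruction \<sigma> = defect_sum s \<sigma> id"
proof -
  define s' where "s' = (SOME s. simplex_lift 2 s \<sigma>)"
  have s': "simplex_lift 2 s' \<sigma>"
    unfolding s'_def by (rule someI [of "\<lambda>s. simplex_lift 2 s \<sigma>", OF s])
  obtain l where l: "continuous_on (standard_simplex 2) l"
    "\<And>x. x \<in> standard_simplex 2 \<Longrightarrow> s' x = cscale (exp (l x)) (s x)"
  proof (rule hopf_lifts_differ_by_exp [OF contracts_to_standard_simplex, of 2 s' s])
    fix l assume "continuous_on (standard_simplex 2) l"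
      "\<And>x. x \<in> standard_simplex 2 \<Longrightarrow> s' x = cscale (exp (l x)) (s x)"
    then show thesis by (rule that)
  qed (use s s' in \<open>auto simp: simplex_lift_def\<close>)
  have defect: "edge_defect s' \<sigma> (simplical_face k)
      = l (simplical_face k (edge_point 1)) - l (simplical_face k (edge_point 0)) + edge_defect s \<sigma> (simplical_face k)"
    if k: "k \<le> 2" for k
  proof -
    have "log_change (s' \<circ> simplical_face k \<circ> edge_point) (s \<circ> simplical_face k \<circ> edge_point)
        = (l \<circ> simplical_face k \<circ> edge_point) 1 - (l \<circ> simplical_face k \<circ> edge_point) 0"
    proof (rule log_change_eq)
      show "continuous_on {0..1} (l \<circ> simplical_face k \<circ> edge_point)"
      proof (intro continuous_on_compose continuous_on_edge_point continuous_on_simplical_face)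
        show "continuous_on (simplical_face k ` edge_point ` {0..1}) l"
          by (rule continuous_on_subset [OF l(1)]) (use face_edge_in [OF k] in blast)
      qed
      fix t :: real assume t: "t \<in> {0..1}"
      show "(s \<circ> simplical_face k \<circ> edge_point) t \<noteq> 0"
        using s face_edge_in [OF k t] by (simp add: simplex_lift_def)
      show "(s' \<circ> simplical_face k \<circ> edge_point) t =
          cscale (exp ((l \<circ> simplical_face k \<circ> edge_point) t)) ((s \<circ> simplical_face k \<circ> edge_point) t)"
        using l(2) [OF face_edge_in [OF k t]] by simp
    qed
    then show ?thesis
      unfolding edge_defect_def
      using log_change_trans [OF path_lift_face [OF s' k] path_lift_face [OF s k] path_lift_face_edge [OF \<sigma> k]]
      by simp
  qed
  have v: "simplical_face 0 (edge_point 0) = simplical_face 2 (edge_point 1)"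
    "simplical_face 0 (edge_point 1) = simplical_face 1 (edge_point 1)"
    "simplical_face 1 (edge_point 0) = simplical_face 2 (edge_point 0)"
    by (auto simp: simplical_face_def edge_point_def fun_eq_iff)
  show ?thesis
    unfolding obstruction_def s'_def [symmetric] defect_sum_def id_o
    using defect [of 0] defect [of 1] defect [of 2] v by simp
qed

lemma simplical_face_commute:
  "k < j \<Longrightarrow> simplical_face j \<circ> simplical_face k = simplical_face k \<circ> simplical_face (j - 1)"
  unfolding simplical_face_def fun_eq_iff by auto

lemma obstruction_face:
  assumes \<rho>: "singular_simplex 3 (nsphere 2) \<rho>" and s: "simplex_lift 3 s \<rho>" and "j \<le> 3"
  shows "obstruction (singular_face 3 j \<rho>) = defect_sum s \<rho> (simplical_face j)"
proof -
  have j: "simplical_face j x \<in> standard_simplex 3" if "x \<in> standard_simplex 2" for x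
    using simplical_face_in_standard_simplex [of 3 j x] that \<open>j \<le> 3\<close> by simp
  have \<sigma>: "singular_simplex 2 (nsphere 2) (singular_face 3 j \<rho>)"
    using singular_simplex_singular_face [OF \<rho> _ \<open>j \<le> 3\<close>] by simp
  have "continuous_on (standard_simplex 2) (s \<circ> simplical_face j)"
  proof (intro continuous_on_compose continuous_on_simplical_face)
    show "continuous_on (simplical_face j ` standard_simplex 2) s"
    proof (rule continuous_on_subset)
      show "continuous_on (standard_simplex 3) s"
        using s by (simp add: simplex_lift_def)
    qed (use j in blast)
  qed
  then have "simplex_lift 2 (s \<circ> simplical_face j) (singular_face 3 j \<rho>)"
    using s by (simp add: simplex_lift_def singular_face_def j)
  from obstruction_eq [OF \<sigma> this]
  have "obstruction (singular_face 3 j \<rho>) = defect_sum (s \<circ> simplical_face j) (singular_face 3 j \<rho>) id" .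
  moreover have "edge_defect (s \<circ> simplical_face j) (singular_face 3 j \<rho>) (simplical_face k)
      = edge_defect s \<rho> (simplical_face j \<circ> simplical_face k)" if "k \<le> 2" for k
  proof -
    have "simplical_face k x \<in> standard_simplex 2" if "x \<in> standard_simplex 1" for x
      using simplical_face_in_standard_simplex [of 2 k x] that \<open>k \<le> 2\<close> by simp
    then have "restrict (singular_face 3 j \<rho> \<circ> simplical_face k) (standard_simplex 1)
        = restrict (\<rho> \<circ> (simplical_face j \<circ> simplical_face k)) (standard_simplex 1)"
      by (auto simp: singular_face_def fun_eq_iff)
    then show ?thesis
      by (simp add: edge_defect_def comp_assoc)
  qed
  ultimately show ?thesis
    by (simp add: defect_sum_def)
qed

text \<open>A lift over the solid 3-simplex restricts to lifts over its four faces, so all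
  twelve edge defects can be computed from this one lift. Each of the six edges lies on
  two faces and is counted with opposite signs.\<close>
lemma obstruction_cocycle:
  assumes \<rho>: "singular_simplex 3 (nsphere 2) \<rho>"
  shows "obstruction (singular_face 3 0 \<rho>) - obstruction (singular_face 3 1 \<rho>)
    + obstruction (singular_face 3 2 \<rho>) - obstruction (singular_face 3 3 \<rho>) = 0"
proof -
  obtain s where s: "simplex_lift 3 s \<rho>"
    using simplex_lift_exists [OF \<rho>] by blast
  have "simplical_face 1 \<circ> simplical_face 0 = simplical_face 0 \<circ> (simplical_face 0 :: (nat\<Rightarrow>real) \<Rightarrow> _)"
    "simplical_face 2 \<circ> simplical_face 0 = simplical_face 0 \<circ> (simplical_face 1 :: (nat\<Rightarrow>real) \<Rightarrow> _)"
    "simplical_face 3 \<circ> simplical_face 0 = simplical_face 0 \<circ> (simplical_face 2 :: (nat\<Rightarrow>real) \<Rightarrow> _)"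
    "simplical_face 2 \<circ> simplical_face 1 = simplical_face 1 \<circ> (simplical_face 1 :: (nat\<Rightarrow>real) \<Rightarrow> _)"
    "simplical_face 3 \<circ> simplical_face 1 = simplical_face 1 \<circ> (simplical_face 2 :: (nat\<Rightarrow>real) \<Rightarrow> _)"
    "simplical_face 3 \<circ> simplical_face 2 = simplical_face 2 \<circ> (simplical_face 2 :: (nat\<Rightarrow>real) \<Rightarrow> _)"
    by (simp_all add: simplical_face_commute)
  then show ?thesis
    by (simp add: obstruction_face [OF \<rho> s] defect_sum_def)
qed

definition chain_obstruction :: "(nat \<Rightarrow> real) chain \<Rightarrow> complex"
  where "chain_obstruction c = (\<Sum>\<sigma>\<in>Poly_Mapping.keys c. of_int (Poly_Mapping.lookup c \<sigma>) * obstruction \<sigma>)"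

text \<open>With a common set containing the supports of two chains, additivity becomes a
  termwise identity.\<close>
lemma chain_obstruction_superset:
  assumes "finite A" "Poly_Mapping.keys c \<subseteq> A"
  shows "chain_obstruction c = (\<Sum>\<sigma>\<in>A. of_int (Poly_Mapping.lookup c \<sigma>) * obstruction \<sigma>)"
  unfolding chain_obstruction_def
  by (rule sum.mono_neutral_left) (use assms in \<open>auto simp: in_keys_iff\<close>)

lemma chain_obstruction_diff:
  "chain_obstruction (a - b) = chain_obstruction a - chain_obstruction b"
proof -
  let ?A = "Poly_Mapping.keys a \<union> Poly_Mapping.keys b"
  have "chain_obstruction x = (\<Sum>\<sigma>\<in>?A. of_int (Poly_Mapping.lookup x \<sigma>) * obstruction \<sigma>)"
    if "x \<in> {a, b, a - b}" for x
    by (rule chain_obstruction_superset) (use that keys_diff [of a b] in auto)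
  then show ?thesis
    by (simp add: lookup_minus left_diff_distrib sum_subtractf)
qed

lemma chain_obstruction_0 [simp]: "chain_obstruction 0 = 0"
  by (simp add: chain_obstruction_def)

lemma chain_obstruction_uminus: "chain_obstruction (- a) = - chain_obstruction a"
  using chain_obstruction_diff [of 0 a] by simp

lemma chain_obstruction_add: "chain_obstruction (a + b) = chain_obstruction a + chain_obstruction b"
  using chain_obstruction_diff [of a "- b"] by (simp add: chain_obstruction_uminus)

lemma chain_obstruction_cmul: "chain_obstruction (frag_cmul n a) = of_int n * chain_obstruction a"
  by (subst chain_obstruction_superset [of "Poly_Mapping.keys a"])
     (auto simp: chain_obstruction_def sum_distrib_left mult.assoc)

lemma chain_obstruction_of [simp]: "chain_obstruction (frag_of \<sigma>) = obstruction \<sigma>"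
  by (simp add: chain_obstruction_def)

lemma chain_obstruction_boundary:
  assumes "singular_chain 3 (nsphere 2) w"
  shows "chain_obstruction (chain_boundary 3 w) = 0"
  using assms unfolding singular_chain_def
proof (induction rule: frag_induction)
  case (one \<rho>)
  then have "singular_simplex 3 (nsphere 2) \<rho>" by simp
  from obstruction_cocycle [OF this] show ?case
    by (simp add: chain_boundary_of numeral_3_eq_3 numeral_2_eq_2 chain_obstruction_add chain_obstruction_diff)
next
  case (diff a b)
  then show ?case by (simp add: chain_boundary_diff chain_obstruction_diff)
qed simp

text \<open>This is where the constant choice of lift over constant edges is needed: all
  comparison factors on the three edges are then constant.\<close>
lemma obstruction_const:
  assumes \<sigma>: "singular_simplex 2 (nsphere 2) \<sigma>" and p: "\<sigma> ` standard_simplex 2 \<subseteq> {p}"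
  shows "obstruction \<sigma> = 0"
proof -
  have "p \<in> topspace (nsphere 2)"
    using p singular_simplex_nsphere(2) [OF \<sigma>] basis_in_standard_simplex [of 0 2] by fastforce
  then obtain v where v: "v \<noteq> 0" "hopf v = p" using hopf_surj by blast
  have "simplex_lift 2 (\<lambda>x. v) \<sigma>"
    using p v unfolding simplex_lift_def by (simp add: image_subset_iff)
  note obstruction_eq [OF \<sigma> this]
  moreover have "edge_defect (\<lambda>x. v) \<sigma> (simplical_face k) = 0" if k: "k \<le> 2" for k
  proof -
    let ?\<tau> = "restrict (\<sigma> \<circ> simplical_face k) (standard_simplex 1)"
    have \<tau>: "singular_simplex 1 (nsphere 2) ?\<tau>"
      using singular_simplex_singular_face [OF \<sigma> _ k] by (simp add: singular_face_def)
    have c: "?\<tau> (edge_point t) = p" if t: "t \<in> {0..1}" for t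
    proof -
      have "\<sigma> (simplical_face k (edge_point t)) = p"
        using p face_edge_in [OF k t] by blast
      then show ?thesis
        using edge_point_in [OF t] by simp
    qed
    then obtain v' where v': "\<And>t. t \<in> {0..1} \<Longrightarrow> edge_lift ?\<tau> t = v'"
      using edge_lift [OF \<tau>] by blast
    have "edge_lift ?\<tau> 0 \<noteq> 0 \<and> hopf (edge_lift ?\<tau> 0) = (?\<tau> \<circ> edge_point) 0"
      using edge_lift [OF \<tau>] unfolding path_lift_def by simp
    then have "v' \<noteq> 0 \<and> hopf v' = p"
      using c [of 0] v' [of 0] by simp
    then show ?thesis
      unfolding edge_defect_def using v v' by (intro log_change_const [where v = v and v' = v']) simp_all
  qed
  ultimately show ?thesis by (simp add: defect_sum_def)
qed

text \<open>A boundary has obstruction zero by the cocycle identity, and the remaining simplices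
  are constant. Hence the obstruction is defined on \<open>H\<^sub>2(S\<^sup>2, p)\<close>.\<close>
lemma chain_obstruction_relboundary:
  assumes "singular_relboundary 2 (nsphere 2) {p} c"
  shows "chain_obstruction c = 0"
proof -
  obtain w e where w: "singular_chain 3 (nsphere 2) w" and e: "singular_chain 2 (subtopology (nsphere 2) {p}) e"
    and c: "chain_boundary 3 w + e = c"
    using assms unfolding singular_relboundary by (auto simp: numeral_3_eq_3 numeral_2_eq_2)
  have "chain_obstruction e = 0"
    unfolding chain_obstruction_def
  proof (intro sum.neutral ballI)
    fix \<sigma> assume "\<sigma> \<in> Poly_Mapping.keys e"
    then have "singular_simplex 2 (nsphere 2) \<sigma> \<and> \<sigma> ` standard_simplex 2 \<subseteq> {p}"
      using e unfolding singular_chain_def by (metis mem_Collect_eq singular_simplex_subtopology subsetD)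
    then show "of_int (Poly_Mapping.lookup e \<sigma>) * obstruction \<sigma> = 0"
      using obstruction_const [of \<sigma> p] by simp
  qed
  with w c show ?thesis
    using chain_obstruction_add [of "chain_boundary 3 w" e] chain_obstruction_boundary by simp
qed

section \<open>The obstruction of a triangle of given degree\<close>

lemma continuous_map_nsphere_iff:
  "continuous_map (top_of_set S) (nsphere n) f \<longleftrightarrow> continuous_on S f \<and> f \<in> S \<rightarrow> topspace (nsphere n)"
  by (simp add: nsphere continuous_map_in_subtopology euclidean_product_topology)

lemma homology_class_int_pow:
  assumes c: "singular_relcycle p X S c"
  shows "homologous_rel_set p X S c [^]\<^bsub>relative_homology_group (int p) X S\<^esub> (d::int)
    = homologous_rel_set p X S (frag_cmul d c)"
proof -
  have hom: "homologous_rel_set p X S \<in> hom (relcycle_group p X S) (relative_homology_group (int p) X S)"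
    using normal.r_coset_hom_Mod [OF normal_subgroup_singular_relboundary_relcycle, of p X S]
    by (simp add: right_coset_singular_relboundary relative_homology_group_def)
  have gh: "group_hom (relcycle_group p X S) (relative_homology_group (int p) X S) (homologous_rel_set p X S)"
    using hom by (simp add: group_hom_def group_hom_axioms_def)
  have "Poly_Mapping.keys c \<subseteq> singular_simplex_set p X"
    using c by (simp add: singular_relcycle singular_chain_def)
  moreover have "c [^]\<^bsub>relcycle_group p X S\<^esub> d = c [^]\<^bsub>chain_group p X\<^esub> d"
    unfolding relcycle_group_def
    by (rule group.int_pow_subgroup_generated [OF group_chain_group])
       (use c in \<open>simp flip: relcycle_group_def\<close>)
  ultimately have "c [^]\<^bsub>relcycle_group p X S\<^esub> d = frag_cmul d c"
    by (simp add: chain_group_def)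
  then show ?thesis
    using group_hom.hom_int_pow [OF gh, of c d] c by simp
qed

lemma sum_standard_simplex_2: "t \<in> standard_simplex 2 \<Longrightarrow> 0 \<le> t 0 \<and> 0 \<le> t 1 \<and> 0 \<le> t 2 \<and> t 0 + t 1 + t 2 = 1"
  by (auto simp: standard_simplex_def numeral_2_eq_2)

lemma sum_standard_simplex_1: "t \<in> standard_simplex 1 \<Longrightarrow> 0 \<le> t 0 \<and> 0 \<le> t 1 \<and> t 0 + t 1 = 1"
  by (auto simp: standard_simplex_def)

lemma affine_triangle_in_hull:
  "t \<in> standard_simplex 2 \<Longrightarrow> affine_triangle a b c t \<in> convex hull {a, b, c}"
  using sum_standard_simplex_2 [of t] unfolding affine_triangle_def convex_hull_3 by auto

lemma singular_simplex_affine_triangle: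
  "singular_simplex 2 (top_of_set (convex hull {a, b, c})) (affine_triangle a b c)"
proof -
  have "continuous_on (standard_simplex 2) (\<lambda>t. t i)" for i :: nat
    by (rule continuous_on_subset [OF continuous_on_product_coordinates subset_UNIV])
  then have "continuous_on (standard_simplex 2) (\<lambda>t. t 0 *\<^sub>R a + t 1 *\<^sub>R b + t 2 *\<^sub>R c)"
    by (intro continuous_on_add continuous_on_scaleR continuous_on_const)
  then have "continuous_on (standard_simplex 2) (affine_triangle a b c)"
    by (rule continuous_on_eq) (simp add: affine_triangle_def)
  moreover have "affine_triangle a b c \<in> standard_simplex 2 \<rightarrow> convex hull {a, b, c}"
    using affine_triangle_in_hull by blast
  moreover have "affine_triangle a b c \<in> extensional (standard_simplex 2)"
    by (simp add: affine_triangle_def)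
  ultimately show ?thesis
    by (simp add: singular_simplex_def continuous_map_in_subtopology euclidean_product_topology)
qed

lemma affine_triangle_face:
  assumes t: "t \<in> standard_simplex 1"
  shows "affine_triangle a b c (simplical_face 0 t) = t 0 *\<^sub>R b + t 1 *\<^sub>R c"
    and "affine_triangle a b c (simplical_face 1 t) = t 0 *\<^sub>R a + t 1 *\<^sub>R c"
    and "affine_triangle a b c (simplical_face 2 t) = t 0 *\<^sub>R a + t 1 *\<^sub>R b"
proof -
  have "simplical_face k t \<in> standard_simplex 2" if "k \<le> 2" for k
    using simplical_face_in_standard_simplex [of 2 k t] t that by simp
  from this [of 0] this [of 1] this [of 2]
  show "affine_triangle a b c (simplical_face 0 t) = t 0 *\<^sub>R b + t 1 *\<^sub>R c"
    "affine_triangle a b c (simplical_face 1 t) = t 0 *\<^sub>R a + t 1 *\<^sub>R c"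
    "affine_triangle a b c (simplical_face 2 t) = t 0 *\<^sub>R a + t 1 *\<^sub>R b"
    by (simp_all add: affine_triangle_def simplical_face_def)
qed

lemma rel_frontier_triangle:
  fixes a b c :: "'a::euclidean_space"
  assumes "\<not> affine_dependent {a, b, c}" "distinct [a, b, c]"
  shows "rel_frontier (convex hull {a, b, c}) = convex hull {b, c} \<union> convex hull {a, c} \<union> convex hull {a, b}"
proof -
  have "{a, b, c} - {a} = {b, c}" "{a, b, c} - {b} = {a, c}" "{a, b, c} - {c} = {a, b}"
    using assms(2) by auto
  then have "(\<lambda>x. convex hull ({a, b, c} - {x})) ` {a, b, c} = {convex hull {b, c}, convex hull {a, c}, convex hull {a, b}}"
    by (simp only: image_insert image_empty)
  then have "rel_frontier (convex hull {a, b, c}) = \<Union> {convex hull {b, c}, convex hull {a, c}, convex hull {a, b}}"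
    using rel_frontier_convex_hull_cases [OF assms(1)] by (simp only: Setcompr_eq_image)
  then show ?thesis
    by (simp add: Un_assoc)
qed

text \<open>The orientation of a triangle modulo its boundary refers to this relative cycle.\<close>
lemma relcycle_affine_triangle:
  fixes a b c :: "'a::euclidean_space"
  assumes "\<not> affine_dependent {a, b, c}" "distinct [a, b, c]"
  shows "singular_relcycle 2 (top_of_set (convex hull {a, b, c})) (rel_frontier (convex hull {a, b, c}))
    (frag_of (affine_triangle a b c))"
proof -
  let ?X = "top_of_set (convex hull {a, b, c})"
  have face: "singular_simplex 1 (subtopology ?X (rel_frontier (convex hull {a, b, c})))
      (singular_face 2 k (affine_triangle a b c))" if k: "k \<le> 2" for k
  proof (rule iffD2 [OF singular_simplex_subtopology], rule conjI)
    show "singular_simplex 1 ?X (singular_face 2 k (affine_triangle a b c))"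
      using singular_simplex_singular_face [OF singular_simplex_affine_triangle _ k] by simp
    have "affine_triangle a b c (simplical_face k t) \<in> rel_frontier (convex hull {a, b, c})"
      if t: "t \<in> standard_simplex 1" for t
    proof -
      have edge: "t 0 *\<^sub>R x + t 1 *\<^sub>R y \<in> convex hull {x, y}" for x y :: 'a
        unfolding convex_hull_2 using sum_standard_simplex_1 [OF t] by blast
      consider "k = 0" | "k = 1" | "k = 2" using k by linarith
      then show ?thesis
      proof cases
        case 1
        then show ?thesis
          unfolding rel_frontier_triangle [OF assms] \<open>k = 0\<close> affine_triangle_face(1) [OF t] using edge by blast
      next
        case 2
        then show ?thesis
          unfolding rel_frontier_triangle [OF assms] \<open>k = 1\<close> affine_triangle_face(2) [OF t] using edge by blast
      next
        case 3
        then show ?thesis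
          unfolding rel_frontier_triangle [OF assms] \<open>k = 2\<close> affine_triangle_face(3) [OF t] using edge by blast
      qed
    qed
    then show "singular_face 2 k (affine_triangle a b c) ` standard_simplex 1 \<subseteq> rel_frontier (convex hull {a, b, c})"
      by (auto simp: singular_face_def)
  qed
  then show ?thesis
    unfolding singular_relcycle
    by (auto simp: singular_chain_of singular_simplex_affine_triangle chain_boundary_of
        intro!: singular_chain_sum singular_chain_cmul)
qed

text \<open>Under \<open>g\<close>, the fundamental class of \<open>(\<phi>, \<partial>\<phi>)\<close> and \<open>d\<close> times the orientation class
  become homologous relative to \<open>p\<close>, and the obstruction only depends on such relative
  classes. The factor given by \<open>\<zeta>\<close> is the same for all triangles, so the cocycle condition
  carries over from degrees to obstructions.\<close>
lemma obstruction_of_degree: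
  assumes aff: "\<not> affine_dependent {a, b, c}" "distinct [a, b, c]" and \<phi>: "\<phi> = convex hull {a, b, c}"
    and g: "continuous_map (triangle_mod_boundary \<phi>) (nsphere 2) g" "g (rel_frontier \<phi>) = p"
    and u: "quotient_orientation a b c \<phi> u"
    and deg: "has_degree (triangle_mod_boundary \<phi>) u \<omega> g d"
    and \<zeta>: "singular_relcycle 2 (nsphere 2) {} \<zeta>" "\<omega> = homologous_rel_set 2 (nsphere 2) {} \<zeta>"
  shows "obstruction (simplex_map 2 (g \<circ> collapse (rel_frontier \<phi>)) (affine_triangle a b c))
    = of_int d * chain_obstruction \<zeta>"
proof -
  let ?F = "rel_frontier \<phi>" and ?Q = "triangle_mod_boundary \<phi>" and ?S = "nsphere 2"
  let ?A = "frag_of (affine_triangle a b c)"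
  have q: "continuous_map (top_of_set \<phi>) ?Q (collapse ?F)"
    using quotient_map_collapse quotient_imp_continuous_map by blast
  have A: "singular_relcycle 2 (top_of_set \<phi>) ?F ?A"
    unfolding \<phi> by (rule relcycle_affine_triangle [OF aff])
  \<comment> \<open>By naturality, the image of \<open>u\<close> in \<open>H\<^sub>2(S\<^sup>2, p)\<close> can be computed through \<open>H\<^sub>2(S\<^sup>2)\<close>, where the degree is given.\<close>
  have "hom_induced 2 ?Q {?F} ?S {p} g (hom_induced 2 ?Q {} ?Q {?F} id u)
      = hom_induced 2 ?Q {} ?S {p} (g \<circ> id) u"
    by (rule hom_induced_compose') (use g in auto)
  also have "\<dots> = hom_induced 2 ?Q {} ?S {p} (id \<circ> g) u"
    by simp
  also have "\<dots> = hom_induced 2 ?S {} ?S {p} id (hom_induced 2 ?Q {} ?S {} g u)"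
    by (rule hom_induced_compose' [symmetric]) (use g in auto)
  also have "hom_induced 2 ?Q {} ?S {} g u = homologous_rel_set 2 ?S {} (frag_cmul d \<zeta>)"
    using deg homology_class_int_pow [OF \<zeta>(1), of d] by (simp add: has_degree_def \<zeta>(2))
  also have "hom_induced 2 ?S {} ?S {p} id (homologous_rel_set 2 ?S {} (frag_cmul d \<zeta>))
      = homologous_rel_set 2 ?S {p} (chain_map 2 id (frag_cmul d \<zeta>))"
    using hom_induced_chain_map [of ?S ?S id "{}" "{p}" 2 "frag_cmul d \<zeta>"] singular_relcycle_cmul [OF \<zeta>(1), of d]
    by simp
  also have "chain_map 2 id (frag_cmul d \<zeta>) = frag_cmul d \<zeta>"
    using chain_map_ident [of 2 ?S] \<zeta>(1) by (simp add: singular_relcycle singular_chain_cmul)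
  finally have 1: "hom_induced 2 ?Q {?F} ?S {p} g (hom_induced 2 ?Q {} ?Q {?F} id u)
    = homologous_rel_set 2 ?S {p} (frag_cmul d \<zeta>)" .
  have "hom_induced 2 ?Q {?F} ?S {p} g (hom_induced 2 (top_of_set \<phi>) ?F ?Q {?F} (collapse ?F)
        (homologous_rel_set 2 (top_of_set \<phi>) ?F ?A))
      = hom_induced 2 (top_of_set \<phi>) ?F ?S {p} (g \<circ> collapse ?F) (homologous_rel_set 2 (top_of_set \<phi>) ?F ?A)"
    by (rule hom_induced_compose') (use g q in \<open>auto simp: collapse_def\<close>)
  also have "\<dots> = homologous_rel_set 2 ?S {p} (chain_map 2 (g \<circ> collapse ?F) ?A)"
    using hom_induced_chain_map [of "top_of_set \<phi>" ?S "g \<circ> collapse ?F" ?F "{p}" 2 ?A] A g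
      continuous_map_compose [OF q g(1)] by (simp add: collapse_def)
  finally have "homologous_rel 2 ?S {p} (frag_cmul d \<zeta>) (chain_map 2 (g \<circ> collapse ?F) ?A)"
    using 1 u unfolding quotient_orientation_def by (metis homologous_rel_set_eq)
  then have "chain_obstruction (frag_cmul d \<zeta> - chain_map 2 (g \<circ> collapse ?F) ?A) = 0"
    unfolding homologous_rel_def by (rule chain_obstruction_relboundary)
  then show ?thesis
    by (simp add: chain_obstruction_diff chain_obstruction_cmul chain_map_of)
qed

lemma log_change_cong:
  "(\<And>t. t \<in> {0..1} \<Longrightarrow> s t = r t) \<Longrightarrow> (\<And>t. t \<in> {0..1} \<Longrightarrow> s' t = r' t) \<Longrightarrow> log_change s s' = log_change r r'"
  unfolding log_change_def by (simp cong: conj_cong)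

text \<open>For a lift \<open>s\<close> over an edge that is mapped to the point below \<open>v\<close>.\<close>
definition edge_winding :: "('a::real_vector \<Rightarrow> complex \<times> complex) \<Rightarrow> complex \<times> complex \<Rightarrow> 'a \<Rightarrow> 'a \<Rightarrow> complex"
  where "edge_winding s v x y = log_change (\<lambda>t. s ((1 - t) *\<^sub>R x + t *\<^sub>R y)) (\<lambda>t. v)"

text \<open>If the boundary is mapped to \<open>p\<close>, every edge can be compared with the same vector
  \<open>v\<close> over \<open>p\<close> instead of its chosen lift, which is constant.\<close>
lemma obstruction_triangle:
  fixes a b c :: "'a::euclidean_space"
  assumes s: "continuous_on (convex hull {a, b, c}) s"
    and lift: "\<And>x. x \<in> convex hull {a, b, c} \<Longrightarrow> s x \<noteq> 0 \<and> hopf (s x) = f x"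
    and f: "\<And>x. x \<in> convex hull {a, b} \<union> convex hull {a, c} \<union> convex hull {b, c} \<Longrightarrow> f x = p"
    and v: "v \<noteq> 0" "hopf v = p"
  shows "obstruction (simplex_map 2 f (affine_triangle a b c))
    = edge_winding s v b c - edge_winding s v a c + edge_winding s v a b"
proof -
  let ?A = "affine_triangle a b c" and ?\<sigma> = "simplex_map 2 f (affine_triangle a b c)"
  let ?H = "convex hull {a, b, c}"
  have A: "?A t \<in> ?H" if "t \<in> standard_simplex 2" for t
    by (rule affine_triangle_in_hull [OF that])
  have cA: "continuous_on (standard_simplex 2) ?A"
    using singular_simplex_affine_triangle [of a b c]
    by (simp add: singular_simplex_def continuous_map_in_subtopology euclidean_product_topology)
  have "continuous_on ?H (\<lambda>x. hopf (s x))"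
    by (rule continuous_on_compose2 [OF continuous_on_hopf s]) (use lift in auto)
  then have "continuous_on ?H f"
    using lift by (simp cong: continuous_on_cong)
  then have cont: "continuous_map (top_of_set ?H) (nsphere 2) f"
  proof -
    have "f x \<in> topspace (nsphere 2)" if "x \<in> ?H" for x
      using lift [OF that] hopf_in_nsphere by metis
    with \<open>continuous_on ?H f\<close> show ?thesis
      by (simp add: continuous_map_nsphere_iff Pi_iff)
  qed
  have \<sigma>: "singular_simplex 2 (nsphere 2) ?\<sigma>"
    by (rule singular_simplex_simplex_map [OF singular_simplex_affine_triangle cont])
  have "continuous_on (standard_simplex 2) (s \<circ> ?A)"
    by (intro continuous_on_compose cA continuous_on_subset [OF s]) (use A in blast)
  then have sl: "simplex_lift 2 (s \<circ> ?A) ?\<sigma>"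
    using lift A by (simp add: simplex_lift_def simplex_map_def)
  have defect: "edge_defect (s \<circ> ?A) ?\<sigma> (simplical_face k) = edge_winding s v x y"
    if k: "k \<le> 2" and face: "\<And>t. t \<in> standard_simplex 1 \<Longrightarrow> ?A (simplical_face k t) = t 0 *\<^sub>R x + t 1 *\<^sub>R y"
      and xy: "convex hull {x, y} \<subseteq> convex hull {a, b} \<union> convex hull {a, c} \<union> convex hull {b, c}" for k x y
  proof -
    let ?\<tau> = "restrict (?\<sigma> \<circ> simplical_face k) (standard_simplex 1)"
    have \<tau>: "singular_simplex 1 (nsphere 2) ?\<tau>"
      using singular_simplex_singular_face [OF \<sigma> _ k] by (simp add: singular_face_def)
    have e: "?A (simplical_face k (edge_point t)) = (1 - t) *\<^sub>R x + t *\<^sub>R y" if "t \<in> {0..1}" for t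
      using face [OF edge_point_in [OF that]] by (simp add: edge_point_def)
    have fp: "f (?A (simplical_face k (edge_point t))) = p" if t: "t \<in> {0..1}" for t
    proof -
      have "(1 - t) *\<^sub>R x + t *\<^sub>R y \<in> convex hull {x, y}"
        using t unfolding segment_convex_hull [symmetric] closed_segment_def by auto
      then show ?thesis
        using xy f unfolding e [OF t] by blast
    qed
    have c: "?\<tau> (edge_point t) = p" if t: "t \<in> {0..1}" for t
      using fp [OF t] edge_point_in [OF t] face_edge_in [OF k t] by (simp add: simplex_map_def)
    then obtain v' where v': "\<And>t. t \<in> {0..1} \<Longrightarrow> edge_lift ?\<tau> t = v'"
      using edge_lift [OF \<tau>] by blast
    have el: "path_lift (edge_lift ?\<tau>) (?\<tau> \<circ> edge_point)"
      using edge_lift [OF \<tau>] by blast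
    then have "edge_lift ?\<tau> 0 \<noteq> 0 \<and> hopf (edge_lift ?\<tau> 0) = (?\<tau> \<circ> edge_point) 0"
      unfolding path_lift_def by simp
    then have vp: "v' \<noteq> 0 \<and> hopf v' = p"
      using c [of 0] v' [of 0] by simp
    have 1: "path_lift (s \<circ> ?A \<circ> simplical_face k \<circ> edge_point) (\<lambda>t. p)"
      using path_lift_face [OF sl k] fp face_edge_in [OF k] by (simp add: path_lift_def simplex_map_def)
    have 2: "path_lift (\<lambda>t. v) (\<lambda>t. p)"
      using v by (simp add: path_lift_def)
    have 3: "path_lift (edge_lift ?\<tau>) (\<lambda>t. p)"
      using el c by (simp add: path_lift_def)
    have "edge_defect (s \<circ> ?A) ?\<sigma> (simplical_face k)
        = log_change (s \<circ> ?A \<circ> simplical_face k \<circ> edge_point) (\<lambda>t. v) + log_change (\<lambda>t. v) (edge_lift ?\<tau>)"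
      unfolding edge_defect_def by (rule log_change_trans [OF 1 2 3])
    also have "log_change (\<lambda>t. v) (edge_lift ?\<tau>) = 0"
      using v vp v' by (intro log_change_const [where v = v and v' = v']) simp_all
    also have "log_change (s \<circ> ?A \<circ> simplical_face k \<circ> edge_point) (\<lambda>t. v) = edge_winding s v x y"
      unfolding edge_winding_def by (rule log_change_cong) (simp_all add: e)
    finally show ?thesis by (simp only: add_0_right)
  qed
  have "obstruction ?\<sigma> = defect_sum (s \<circ> ?A) ?\<sigma> id"
    by (rule obstruction_eq [OF \<sigma> sl])
  also have "\<dots> = edge_defect (s \<circ> ?A) ?\<sigma> (simplical_face 0)
      - edge_defect (s \<circ> ?A) ?\<sigma> (simplical_face 1) + edge_defect (s \<circ> ?A) ?\<sigma> (simplical_face 2)"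
    by (simp only: defect_sum_def id_o)
  also have "edge_defect (s \<circ> ?A) ?\<sigma> (simplical_face 0) = edge_winding s v b c"
    by (rule defect [OF _ affine_triangle_face(1)]) auto
  also have "edge_defect (s \<circ> ?A) ?\<sigma> (simplical_face 1) = edge_winding s v a c"
    by (rule defect [OF _ affine_triangle_face(2)]) auto
  also have "edge_defect (s \<circ> ?A) ?\<sigma> (simplical_face 2) = edge_winding s v a b"
    by (rule defect [OF _ affine_triangle_face(3)]) auto
  finally show ?thesis .
qed

section \<open>Extension over a tetrahedron\<close>

lemma edge_winding_diff:
  fixes x y :: "'a::real_normed_vector"
  assumes l: "continuous_on (closed_segment x y) l"
    and s: "continuous_on (closed_segment x y) s" "\<And>z. z \<in> closed_segment x y \<Longrightarrow> s z \<noteq> 0 \<and> hopf (s z) = p"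
    and s': "continuous_on (closed_segment x y) s'" "\<And>z. z \<in> closed_segment x y \<Longrightarrow> s' z \<noteq> 0 \<and> hopf (s' z) = p"
    and eq: "\<And>z. z \<in> closed_segment x y \<Longrightarrow> s z = cscale (exp (l z)) (s' z)"
    and v: "v \<noteq> 0" "hopf v = p"
  shows "edge_winding s v x y = l y - l x + edge_winding s' v x y"
proof -
  define h where "h = (\<lambda>t::real. (1 - t) *\<^sub>R x + t *\<^sub>R y)"
  have h: "h t \<in> closed_segment x y" if "t \<in> {0..1}" for t
    using that unfolding h_def closed_segment_def by auto
  then have him: "h ` {0..1} \<subseteq> closed_segment x y" by blast
  have ch: "continuous_on {0..1} h"
    unfolding h_def by (intro continuous_intros)
  have lift: "path_lift (\<lambda>t. r (h t)) (\<lambda>t. p)"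
    if "continuous_on (closed_segment x y) r" "\<And>z. z \<in> closed_segment x y \<Longrightarrow> r z \<noteq> 0 \<and> hopf (r z) = p" for r
  proof -
    have "continuous_on {0..1} (\<lambda>t. r (h t))"
      by (rule continuous_on_compose2 [OF that(1) ch him])
    then show ?thesis
      using that(2) h by (simp add: path_lift_def)
  qed
  have "path_lift (\<lambda>t. v) (\<lambda>t. p)"
    using v by (simp add: path_lift_def)
  then have "edge_winding s v x y = log_change (\<lambda>t. s (h t)) (\<lambda>t. s' (h t)) + edge_winding s' v x y"
    unfolding edge_winding_def h_def [symmetric]
    using log_change_trans [OF lift [OF s] lift [OF s']] by (simp only: h_def)
  moreover have "log_change (\<lambda>t. s (h t)) (\<lambda>t. s' (h t)) = l (h 1) - l (h 0)"
  proof (rule log_change_eq)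
    show "continuous_on {0..1} (\<lambda>t. l (h t))"
      by (rule continuous_on_compose2 [OF l ch him])
  qed (use s' eq h in auto)
  ultimately show ?thesis
    by (simp add: h_def)
qed

text \<open>The two edges at \<open>b\<close> form a contractible set, so the factor between \<open>s\<close> and \<open>s'\<close> has
  a logarithm there, and another one on the third edge. Equal total windings mean that the
  two logarithms differ by the same constant at \<open>c\<close> and at \<open>d\<close>, so that they can be made
  to fit.\<close>
lemma exp_ratio_around_triangle:
  fixes b c d :: "'a::euclidean_space"
  assumes aff: "\<not> affine_dependent {b, c, d}" "distinct [b, c, d]"
    and E: "E = closed_segment b c \<union> closed_segment b d \<union> closed_segment c d"
    and s: "continuous_on E s" "\<And>x. x \<in> E \<Longrightarrow> s x \<noteq> 0 \<and> hopf (s x) = p"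
    and s': "continuous_on E s'" "\<And>x. x \<in> E \<Longrightarrow> s' x \<noteq> 0 \<and> hopf (s' x) = p"
    and v: "v \<noteq> 0" "hopf v = p"
    and winding: "edge_winding s v c d - edge_winding s v b d + edge_winding s v b c
      = edge_winding s' v c d - edge_winding s' v b d + edge_winding s' v b c"
  obtains m where "continuous_on E m" "\<And>x. x \<in> E \<Longrightarrow> s x = cscale (exp (m x)) (s' x)"
proof -
  define E2 where "E2 = closed_segment b c \<union> closed_segment b d"
  have EE: "E = E2 \<union> closed_segment c d" by (simp add: E E2_def)
  have sub: "closed_segment b c \<subseteq> E2" "closed_segment b d \<subseteq> E2" "E2 \<subseteq> E" "closed_segment c d \<subseteq> E"
    "closed_segment b c \<subseteq> E" "closed_segment b d \<subseteq> E"
    by (auto simp: E E2_def)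
  have E2: "contracts_to E2 b"
  proof (rule contracts_to_starlike)
    show "compact E2" unfolding E2_def by (intro compact_Un compact_segment)
    show "b \<in> E2" by (simp add: E2_def)
    show "closed_segment b x \<subseteq> E2" if "x \<in> E2" for x
      using that subset_closed_segment [of b x b c] subset_closed_segment [of b x b d]
      by (auto simp: E2_def)
  qed
  obtain l where l: "continuous_on E2 l" "\<And>x. x \<in> E2 \<Longrightarrow> s x = cscale (exp (l x)) (s' x)"
  proof (rule hopf_lifts_differ_by_exp [OF E2, of s s'])
    show "continuous_on E2 s" "continuous_on E2 s'"
      using s(1) s'(1) sub continuous_on_subset by blast+
    fix x assume "x \<in> E2"
    then have "x \<in> E" using sub by blast
    then show "s x \<noteq> 0" "s' x \<noteq> 0" "hopf (s x) = hopf (s' x)"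
      using s(2) s'(2) by auto
  qed blast
  have E3: "contracts_to (closed_segment c d) c"
    by (rule contracts_to_starlike) (auto simp: subset_closed_segment)
  obtain l' where l': "continuous_on (closed_segment c d) l'"
    "\<And>x. x \<in> closed_segment c d \<Longrightarrow> s x = cscale (exp (l' x)) (s' x)"
  proof (rule hopf_lifts_differ_by_exp [OF E3, of s s'])
    show "continuous_on (closed_segment c d) s" "continuous_on (closed_segment c d) s'"
      using s(1) s'(1) sub continuous_on_subset by blast+
    fix x assume "x \<in> closed_segment c d"
    then have "x \<in> E" using sub by blast
    then show "s x \<noteq> 0" "s' x \<noteq> 0" "hopf (s x) = hopf (s' x)"
      using s(2) s'(2) by auto
  qed blast
  have diff: "edge_winding s v x y = j y - j x + edge_winding s' v x y"
    if j: "closed_segment x y \<subseteq> E" "continuous_on (closed_segment x y) j"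
      "\<And>z. z \<in> closed_segment x y \<Longrightarrow> s z = cscale (exp (j z)) (s' z)" for x y j
  proof (rule edge_winding_diff [OF j(2) _ _ _ _ j(3) v])
    show "continuous_on (closed_segment x y) s" "continuous_on (closed_segment x y) s'"
      using s(1) s'(1) j(1) continuous_on_subset by blast+
    fix z assume "z \<in> closed_segment x y"
    then have "z \<in> E" using j by blast
    then show "s z \<noteq> 0 \<and> hopf (s z) = p" "s' z \<noteq> 0 \<and> hopf (s' z) = p"
      using s(2) s'(2) by auto
  qed
  have bc: "edge_winding s v b c = l c - l b + edge_winding s' v b c"
    by (rule diff [OF sub(5) continuous_on_subset [OF l(1) sub(1)]]) (use l(2) sub in blast)
  have bd: "edge_winding s v b d = l d - l b + edge_winding s' v b d"
    by (rule diff [OF sub(6) continuous_on_subset [OF l(1) sub(2)]]) (use l(2) sub in blast)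
  have cd: "edge_winding s v c d = l' d - l' c + edge_winding s' v c d"
    by (rule diff [OF sub(4) l'])
  \<comment> \<open>Equality of the total windings forces the two logarithms to differ by the same \<open>k\<close> at \<open>c\<close> and \<open>d\<close>.\<close>
  define k where "k = l' c - l c"
  have kd: "l' d - l d = k"
    using winding unfolding bc bd cd k_def by (simp add: algebra_simps)
  have "cscale (exp (l' c)) (s' c) = cscale (exp (l c)) (s' c)" "s' c \<noteq> 0"
    using l'(2) [of c] l(2) [of c] s'(2) [of c] by (auto simp: E2_def E)
  then have "exp k = 1"
    by (simp add: cscale_cancel k_def exp_diff)
  define m where "m = (\<lambda>x. if x \<in> E2 then l x else l' x - k)"
  have int: "x = c \<or> x = d" if "x \<in> E2" "x \<in> closed_segment c d" for x
  proof -
    have "convex hull {b, c} \<inter> convex hull {c, d} = convex hull ({b, c} \<inter> {c, d})"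
      "convex hull {b, d} \<inter> convex hull {c, d} = convex hull ({b, d} \<inter> {c, d})"
      by (intro convex_hull_Int [symmetric]; use aff in \<open>simp add: insert_commute\<close>)+
    moreover have "{b, c} \<inter> {c, d} = {c}" "{b, d} \<inter> {c, d} = {d}"
      using aff(2) by auto
    ultimately show ?thesis
      using that unfolding E2_def segment_convex_hull by auto
  qed
  have "continuous_on (E2 \<union> closed_segment c d) m"
    unfolding m_def
  proof (rule continuous_on_cases)
    show "closed E2" unfolding E2_def by (intro closed_Un closed_segment)
    show "\<forall>x. x \<in> E2 \<and> \<not> x \<in> E2 \<or> x \<in> closed_segment c d \<and> x \<in> E2 \<longrightarrow> l x = l' x - k"
    proof (intro allI impI)
      fix x assume "x \<in> E2 \<and> \<not> x \<in> E2 \<or> x \<in> closed_segment c d \<and> x \<in> E2"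
      then have "x = c \<or> x = d" using int by blast
      then show "l x = l' x - k" using kd by (auto simp: k_def algebra_simps)
    qed
  qed (use l l' in \<open>auto intro: continuous_on_diff\<close>)
  then have "continuous_on E m" by (simp add: EE)
  moreover have "s x = cscale (exp (m x)) (s' x)" if "x \<in> E" for x
    using that l(2) l'(2) \<open>exp k = 1\<close> by (auto simp: m_def EE exp_diff)
  ultimately show thesis by (rule that)
qed

text \<open>The three faces at \<open>a\<close> form a set that is starlike at \<open>a\<close>, so \<open>f\<close> lifts over it, and
  it also lifts over the fourth face. By the cocycle condition both lifts have the same
  total winding along the boundary of that face. Their ratio on this boundary therefore
  has a logarithm, which extends over the face by Tietze's theorem and corrects the second
  lift to agree with the first.\<close>
lemma hopf_lift_tetrahedron_boundary:
  fixes a b c d :: "'a::euclidean_space"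
  assumes aff: "\<not> affine_dependent {a, b, c, d}" "distinct [a, b, c, d]"
    and f: "continuous_on (rel_frontier (convex hull {a, b, c, d})) f"
      "f \<in> rel_frontier (convex hull {a, b, c, d}) \<rightarrow> topspace (nsphere 2)"
    and p: "\<forall>x \<in> {a, b, c, d}. \<forall>y \<in> {a, b, c, d}. \<forall>z \<in> convex hull {x, y}. f z = p"
    and cocycle: "obstruction (simplex_map 2 f (affine_triangle b c d))
      - obstruction (simplex_map 2 f (affine_triangle a c d))
      + obstruction (simplex_map 2 f (affine_triangle a b d))
      - obstruction (simplex_map 2 f (affine_triangle a b c)) = 0"
  obtains s where "continuous_on (rel_frontier (convex hull {a, b, c, d})) s"
    "\<And>x. x \<in> rel_frontier (convex hull {a, b, c, d}) \<Longrightarrow> s x \<noteq> 0 \<and> hopf (s x) = f x"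
proof -
  note p = p [rule_format]
  let ?B = "convex hull {b, c, d}"
  define D where "D = convex hull {a, c, d} \<union> convex hull {a, b, d} \<union> convex hull {a, b, c}"
  define R where "R = rel_frontier (convex hull {a, b, c, d})"
  have R: "R = D \<union> ?B"
  proof -
    have "{a, b, c, d} - {a} = {b, c, d}" "{a, b, c, d} - {b} = {a, c, d}"
      "{a, b, c, d} - {c} = {a, b, d}" "{a, b, c, d} - {d} = {a, b, c}"
      using aff(2) by auto
    then have "(\<lambda>x. convex hull ({a, b, c, d} - {x})) ` {a, b, c, d}
        = {convex hull {b, c, d}, convex hull {a, c, d}, convex hull {a, b, d}, convex hull {a, b, c}}"
      by (simp only: image_insert image_empty)
    then have "R = \<Union> {convex hull {b, c, d}, convex hull {a, c, d}, convex hull {a, b, d}, convex hull {a, b, c}}"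
      using rel_frontier_convex_hull_cases [OF aff(1)] unfolding R_def by (simp only: Setcompr_eq_image)
    then show ?thesis
      unfolding D_def by blast
  qed
  have fD: "continuous_on D f" "f \<in> D \<rightarrow> topspace (nsphere 2)"
    and fB: "continuous_on ?B f" "f \<in> ?B \<rightarrow> topspace (nsphere 2)"
    using f continuous_on_subset [of R f] unfolding R_def [symmetric] R by auto
  have cpt: "compact (convex hull {x, y, z})" for x y z :: 'a
    by (simp add: finite_imp_compact_convex_hull)
  have star: "closed_segment x u \<subseteq> convex hull {x, y, z}" if "u \<in> convex hull {x, y, z}" for x y z u :: 'a
    by (rule closed_segment_subset [OF _ that convex_convex_hull]) (simp add: hull_inc)
  have D: "contracts_to D a"
  proof (rule contracts_to_starlike)
    show "compact D" unfolding D_def by (intro compact_Un cpt)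
    show "a \<in> D" by (simp add: D_def hull_inc)
    show "closed_segment a u \<subseteq> D" if "u \<in> D" for u
      using that star [of u a c d] star [of u a b d] star [of u a b c] unfolding D_def by blast
  qed
  obtain sD where sD: "continuous_on D sD" "\<And>x. x \<in> D \<Longrightarrow> sD x \<noteq> 0 \<and> hopf (sD x) = f x"
    using hopf_lift [OF D fD] by blast
  have B: "contracts_to ?B b"
    by (rule contracts_to_starlike [OF cpt _ star]) (simp_all add: hull_inc)
  obtain sB where sB: "continuous_on ?B sB" "\<And>x. x \<in> ?B \<Longrightarrow> sB x \<noteq> 0 \<and> hopf (sB x) = f x"
    using hopf_lift [OF B fB] by blast
  have "a \<in> D" by (simp add: D_def hull_inc)
  then have "f a \<in> topspace (nsphere 2)" using fD(2) by blast
  moreover have "f a = p" by (rule p [of a a]) (simp_all add: hull_inc)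
  ultimately obtain v where v: "v \<noteq> 0" "hopf v = p"
    using hopf_surj by metis
  have tri: "obstruction (simplex_map 2 f (affine_triangle x y z))
      = edge_winding s v y z - edge_winding s v x z + edge_winding s v x y"
    if "convex hull {x, y, z} \<subseteq> A" "continuous_on A s" "\<And>u. u \<in> A \<Longrightarrow> s u \<noteq> 0 \<and> hopf (s u) = f u"
      "x \<in> {a, b, c, d}" "y \<in> {a, b, c, d}" "z \<in> {a, b, c, d}" for x y z A s
  proof (rule obstruction_triangle [OF continuous_on_subset [OF that(2,1)] _ _ v])
    show "s u \<noteq> 0 \<and> hopf (s u) = f u" if "u \<in> convex hull {x, y, z}" for u
      using \<open>convex hull {x, y, z} \<subseteq> A\<close> that \<open>\<And>u. u \<in> A \<Longrightarrow> s u \<noteq> 0 \<and> hopf (s u) = f u\<close> by blast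
    show "f u = p" if "u \<in> convex hull {x, y} \<union> convex hull {x, z} \<union> convex hull {y, z}" for u
      using that p [of x y u] p [of x z u] p [of y z u]
        \<open>x \<in> {a, b, c, d}\<close> \<open>y \<in> {a, b, c, d}\<close> \<open>z \<in> {a, b, c, d}\<close> by blast
  qed
  have subD: "convex hull {a, c, d} \<subseteq> D" "convex hull {a, b, d} \<subseteq> D" "convex hull {a, b, c} \<subseteq> D"
    unfolding D_def by blast+
  have winding: "edge_winding sD v c d - edge_winding sD v b d + edge_winding sD v b c
      = edge_winding sB v c d - edge_winding sB v b d + edge_winding sB v b c"
    using cocycle tri [OF subD(1) sD] tri [OF subD(2) sD] tri [OF subD(3) sD] tri [OF order_refl sB]
    by (simp add: algebra_simps)
  define E where "E = closed_segment b c \<union> closed_segment b d \<union> closed_segment c d"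
  have DB: "D \<inter> ?B = E"
  proof -
    have "convex hull {a, c, d} \<inter> ?B = convex hull ({a, c, d} \<inter> {b, c, d})"
      "convex hull {a, b, d} \<inter> ?B = convex hull ({a, b, d} \<inter> {b, c, d})"
      "convex hull {a, b, c} \<inter> ?B = convex hull ({a, b, c} \<inter> {b, c, d})"
      by (intro convex_hull_Int [symmetric]; use aff in \<open>simp add: insert_commute\<close>)+
    moreover have "{a, c, d} \<inter> {b, c, d} = {c, d}" "{a, b, d} \<inter> {b, c, d} = {b, d}" "{a, b, c} \<inter> {b, c, d} = {b, c}"
      using aff(2) by auto
    ultimately have "D \<inter> ?B = convex hull {c, d} \<union> convex hull {b, d} \<union> convex hull {b, c}"
      by (simp only: D_def Int_Un_distrib2)
    then show ?thesis
      unfolding E_def segment_convex_hull by blast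
  qed
  have fE: "f x = p" if "x \<in> E" for x
    using that p unfolding E_def segment_convex_hull by blast
  have "\<not> affine_dependent {b, c, d}"
    using affine_independent_subset [OF aff(1)] by blast
  moreover have "distinct [b, c, d]" using aff(2) by simp
  ultimately obtain m where m: "continuous_on E m" "\<And>x. x \<in> E \<Longrightarrow> sD x = cscale (exp (m x)) (sB x)"
  proof (rule exp_ratio_around_triangle [OF _ _ E_def _ _ _ _ v winding])
    show "continuous_on E sD" "continuous_on E sB"
      using sD(1) sB(1) DB continuous_on_subset by blast+
    fix x assume "x \<in> E"
    then show "sD x \<noteq> 0 \<and> hopf (sD x) = p" "sB x \<noteq> 0 \<and> hopf (sB x) = p"
      using sD(2) [of x] sB(2) [of x] fE [of x] DB by auto
  qed blast
  have "closedin (top_of_set ?B) E"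
    using DB compact_imp_closed D by (metis closedin_closed_Int contracts_to_def inf_commute)
  then obtain g where g: "continuous_on ?B g" "\<And>x. x \<in> E \<Longrightarrow> g x = m x"
    using Tietze_unbounded [OF m(1)] by blast
  define s where "s = (\<lambda>x. if x \<in> D then sD x else cscale (exp (g x)) (sB x))"
  have "continuous_on (D \<union> ?B) s"
    unfolding s_def
  proof (rule continuous_on_cases)
    show "closed D" using D compact_imp_closed by (auto simp: contracts_to_def)
    show "closed ?B" using cpt compact_imp_closed by blast
    show "continuous_on ?B (\<lambda>x. cscale (exp (g x)) (sB x))"
      unfolding cscale_def by (intro continuous_intros g sB)
    show "\<forall>x. x \<in> D \<and> \<not> x \<in> D \<or> x \<in> ?B \<and> x \<in> D \<longrightarrow> sD x = cscale (exp (g x)) (sB x)"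
      using DB m(2) g(2) by auto
  qed (rule sD)
  moreover have "s x \<noteq> 0 \<and> hopf (s x) = f x" if "x \<in> R" for x
    using that sD(2) [of x] sB(2) [of x] hopf_cscale [of "exp (g x)" "sB x"] by (auto simp: R s_def)
  ultimately show thesis
    using that [of s] by (simp add: R_def [symmetric] R)
qed

text \<open>After normalisation the lift is a map from a 2-sphere to the unit sphere \<open>S\<^sup>3\<close> of
  \<open>\<complex>\<^sup>2\<close>. For dimension reasons it extends over the tetrahedron, and the Hopf map brings
  the extension back to \<open>S\<^sup>2\<close>.\<close>
lemma tetrahedron_extension:
  fixes a b c d :: "'a::euclidean_space"
  assumes aff: "\<not> affine_dependent {a, b, c, d}" "distinct [a, b, c, d]"
    and f: "continuous_on (rel_frontier (convex hull {a, b, c, d})) f"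
      "f \<in> rel_frontier (convex hull {a, b, c, d}) \<rightarrow> topspace (nsphere 2)"
    and p: "\<forall>x \<in> {a, b, c, d}. \<forall>y \<in> {a, b, c, d}. \<forall>z \<in> convex hull {x, y}. f z = p"
    and cocycle: "obstruction (simplex_map 2 f (affine_triangle b c d))
      - obstruction (simplex_map 2 f (affine_triangle a c d))
      + obstruction (simplex_map 2 f (affine_triangle a b d))
      - obstruction (simplex_map 2 f (affine_triangle a b c)) = 0"
  obtains F where "continuous_on (convex hull {a, b, c, d}) F"
    "F \<in> convex hull {a, b, c, d} \<rightarrow> topspace (nsphere 2)"
    "\<And>x. x \<in> rel_frontier (convex hull {a, b, c, d}) \<Longrightarrow> F x = f x"
proof -
  let ?T = "convex hull {a, b, c, d}"
  obtain s where s: "continuous_on (rel_frontier ?T) s"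
    "\<And>x. x \<in> rel_frontier ?T \<Longrightarrow> s x \<noteq> 0 \<and> hopf (s x) = f x"
    using hopf_lift_tetrahedron_boundary [OF assms] by blast
  define n where "n = (\<lambda>x. s x /\<^sub>R norm (s x))"
  have n: "continuous_on (rel_frontier ?T) n"
    unfolding n_def by (intro continuous_intros s) (use s in auto)
  have nim: "n \<in> rel_frontier ?T \<rightarrow> rel_frontier (cball 0 1)"
    using s(2) by (auto simp: n_def)
  have "compact ?T"
    by (simp add: finite_imp_compact_convex_hull)
  then have "closed (rel_frontier ?T)" "rel_frontier ?T \<subseteq> ?T"
    using closed_rel_frontier compact_imp_closed rel_frontier_def closure_closed by blast+
  moreover have "aff_dim ?T < aff_dim (cball (0 :: complex \<times> complex) 1)"
    using aff_dim_affine_independent [OF aff(1)] aff(2) by (simp add: aff_dim_convex_hull aff_dim_cball)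
  moreover have "polytope ?T"
    unfolding polytope_def by (intro exI [of _ "{a, b, c, d}"]) simp
  ultimately obtain G where G: "continuous_on ?T G" "G \<in> ?T \<rightarrow> rel_frontier (cball 0 1)"
    "\<And>x. x \<in> rel_frontier ?T \<Longrightarrow> G x = n x"
    using extend_map_cell_complex_to_sphere [of "{?T}" "rel_frontier ?T" "cball (0 :: complex \<times> complex) 1" n] n nim
    by (auto simp: face_of_refl)
  have nz: "G x \<noteq> 0" if "x \<in> ?T" for x
    using G(2) that by (auto simp: Pi_iff)
  show thesis
  proof
    show "continuous_on ?T (hopf \<circ> G)"
      by (intro continuous_on_compose G continuous_on_subset [OF continuous_on_hopf]) (use nz in auto)
    show "hopf \<circ> G \<in> ?T \<rightarrow> topspace (nsphere 2)"
      using nz hopf_in_nsphere by auto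
    fix x assume x: "x \<in> rel_frontier ?T"
    have "n x = cscale (of_real (inverse (norm (s x)))) (s x)"
      by (simp add: n_def cscale_def prod_eq_iff scaleR_conv_of_real)
    then show "(hopf \<circ> G) x = f x"
      using G(3) [OF x] s(2) [OF x] hopf_cscale [of "of_real (inverse (norm (s x)))" "s x"] by simp
  qed
qed

section \<open>Extension over a simplicial complex\<close>

lemma linear_order_sorted_list:
  assumes r: "linear_order_on A r" and "finite V" "V \<subseteq> A"
  shows "\<exists>vs. set vs = V \<and> sorted_wrt (\<lambda>x y. (x, y) \<in> r \<and> x \<noteq> y) vs"
  using \<open>finite V\<close> \<open>V \<subseteq> A\<close>
proof (induction rule: finite_induct)
  case empty
  show ?case by (intro exI [of _ "[]"]) simp
next
  case (insert m V)
  then obtain vs where vs: "set vs = V" "sorted_wrt (\<lambda>x y. (x, y) \<in> r \<and> x \<noteq> y) vs"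
    by blast
  let ?lo = "filter (\<lambda>x. (x, m) \<in> r) vs" and ?hi = "filter (\<lambda>x. (x, m) \<notin> r) vs"
  have "trans r" "total_on A r"
    using r by (auto simp: order_on_defs)
  have hi: "(m, y) \<in> r" if "y \<in> set ?hi" for y
    using that vs insert \<open>total_on A r\<close> unfolding total_on_def by auto
  have "sorted_wrt (\<lambda>x y. (x, y) \<in> r \<and> x \<noteq> y) (?lo @ m # ?hi)"
    unfolding sorted_wrt_append
  proof (intro conjI ballI)
    fix x y assume x: "x \<in> set ?lo" and y: "y \<in> set (m # ?hi)"
    from y show "(x, y) \<in> r"
      using x hi transD [OF \<open>trans r\<close>, of x m y] by auto
    show "x \<noteq> y"
      using x y insert vs by auto
  next
    show "sorted_wrt (\<lambda>x y. (x, y) \<in> r \<and> x \<noteq> y) (m # ?hi)"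
      using vs hi insert by (auto intro: sorted_wrt_filter)
  qed (rule sorted_wrt_filter [OF vs(2)])
  moreover have "set (?lo @ m # ?hi) = insert m V"
    using vs by auto
  ultimately show ?case by blast
qed

lemma sorted_wrt_neq_imp_distinct: "sorted_wrt (\<lambda>x y. P x y \<and> x \<noteq> y) vs \<Longrightarrow> distinct vs"
  by (induction vs) auto

lemma simplicial_complex_face:
  assumes "simplicial_complex X" "convex hull C \<in> X" "\<not> affine_dependent C" "F \<subseteq> C"
  shows "convex hull F \<in> X"
  using assms face_of_convex_hull_affine_independent [of C "convex hull F"]
  unfolding simplicial_complex_def by blast

lemma simplex_in_order_exists:
  assumes X: "simplicial_complex X" and r: "linear_order_on (complex_vertices X) r"
    and S: "S \<in> X" "aff_dim S = int k"
  obtains vs where "length vs = Suc k" "simplex_in_order r vs S"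
proof -
  obtain n where "n simplex S" using X S by (auto simp: simplicial_complex_def)
  moreover then have "n = int k" using S(2) aff_dim_simplex by metis
  ultimately obtain C where C: "\<not> affine_dependent C" "int (card C) = int k + 1" "S = convex hull C"
    by (auto simp: simplex_def)
  have "C \<subseteq> complex_vertices X"
  proof
    fix x assume "x \<in> C"
    then have "convex hull {x} \<in> X"
      using simplicial_complex_face [OF X _ C(1), of "{x}"] S C by auto
    then show "x \<in> complex_vertices X" by (simp add: complex_vertices_def)
  qed
  then obtain vs where vs: "set vs = C" "sorted_wrt (\<lambda>x y. (x, y) \<in> r \<and> x \<noteq> y) vs"
    using linear_order_sorted_list [OF r aff_independent_finite [OF C(1)]] by blast
  have "length vs = card C"
    using distinct_card [OF sorted_wrt_neq_imp_distinct [OF vs(2)]] vs(1) by simp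
  then have "length vs = Suc k" using C(2) by simp
  moreover have "simplex_in_order r vs S"
    using vs C by (simp add: simplex_in_order_def)
  ultimately show thesis by (rule that)
qed

lemma collapsed_triangle_map:
  assumes ord: "simplex_in_order r [a, b, c] \<phi>"
    and g: "\<exists>g u. continuous_map (triangle_mod_boundary \<phi>) (nsphere 2) g \<and>
        g (rel_frontier \<phi>) = p \<and>
        quotient_orientation a b c \<phi> u \<and>
        has_degree (triangle_mod_boundary \<phi>) u \<omega> g n \<and>
        (\<forall>x \<in> \<phi>. f x = g (collapse (rel_frontier \<phi>) x))"
    and \<zeta>: "singular_relcycle 2 (nsphere 2) {} \<zeta>" "\<omega> = homologous_rel_set 2 (nsphere 2) {} \<zeta>"
  shows "continuous_map (top_of_set \<phi>) (nsphere 2) f"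
    and "obstruction (simplex_map 2 f (affine_triangle a b c)) = of_int n * chain_obstruction \<zeta>"
proof -
  obtain g u where g: "continuous_map (triangle_mod_boundary \<phi>) (nsphere 2) g" "g (rel_frontier \<phi>) = p"
    and u: "quotient_orientation a b c \<phi> u" "has_degree (triangle_mod_boundary \<phi>) u \<omega> g n"
    and f: "\<And>x. x \<in> \<phi> \<Longrightarrow> f x = (g \<circ> collapse (rel_frontier \<phi>)) x"
    using g by auto
  have \<phi>: "\<not> affine_dependent {a, b, c}" "distinct [a, b, c]" "\<phi> = convex hull {a, b, c}"
    using ord by (auto simp: simplex_in_order_def)
  have "continuous_map (top_of_set \<phi>) (triangle_mod_boundary \<phi>) (collapse (rel_frontier \<phi>))"
    by (rule quotient_imp_continuous_map [OF quotient_map_collapse])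
  from continuous_map_compose [OF this g(1)] show "continuous_map (top_of_set \<phi>) (nsphere 2) f"
    by (rule continuous_map_eq) (simp add: f)
  have "simplex_map 2 f (affine_triangle a b c) = simplex_map 2 (g \<circ> collapse (rel_frontier \<phi>)) (affine_triangle a b c)"
    using singular_simplex_affine_triangle [of a b c] f unfolding \<phi>(3) [symmetric]
    by (intro simplex_map_eq [where X = "top_of_set \<phi>"]) simp_all
  then show "obstruction (simplex_map 2 f (affine_triangle a b c)) = of_int n * chain_obstruction \<zeta>"
    using obstruction_of_degree [OF \<phi> g u \<zeta>] by simp
qed

text \<open>Two simplices of dimension at most 3 meet in a common face, which lies in the
  2-skeleton unless both are the same 3-simplex. Hence the extensions over the 3-simplices
  agree where they overlap.\<close>
lemma extend_over_3_simplices: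
  fixes f :: "'a::euclidean_space \<Rightarrow> nat \<Rightarrow> real"
  assumes X: "simplicial_complex X"
    and f2: "\<And>S. S \<in> skeleton 2 X \<Longrightarrow> continuous_map (top_of_set S) (nsphere n) f"
    and ext: "\<And>T. T \<in> X \<Longrightarrow> aff_dim T = 3 \<Longrightarrow> \<exists>F. continuous_map (top_of_set T) (nsphere n) F \<and>
      (\<forall>x \<in> rel_frontier T. F x = f x)"
  shows "\<exists>F. continuous_map (top_of_set (\<Union> (skeleton 3 X))) (nsphere n) F \<and>
    (\<forall>x \<in> \<Union> (skeleton 2 X). F x = f x)"
proof -
  obtain H where H: "\<And>T. T \<in> X \<Longrightarrow> aff_dim T = 3 \<Longrightarrow> continuous_map (top_of_set T) (nsphere n) (H T)"
    "\<And>T x. T \<in> X \<Longrightarrow> aff_dim T = 3 \<Longrightarrow> x \<in> rel_frontier T \<Longrightarrow> H T x = f x"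
    using ext by metis
  define F where "F = (\<lambda>x. if x \<in> \<Union> (skeleton 2 X) then f x
    else H (SOME T. T \<in> X \<and> aff_dim T = 3 \<and> x \<in> T) x)"
  have convex: "convex S" and closed: "closed S" if S: "S \<in> X" for S
  proof -
    obtain k where "k simplex S"
      using X S unfolding simplicial_complex_def by blast
    then show "convex S" "closed S"
      by (rule convex_simplex, rule closed_simplex)
  qed
  have face: "S \<inter> T \<in> X" "S \<inter> T face_of T" if "S \<in> X" "T \<in> X" for S T
  proof -
    show "S \<inter> T face_of T"
      using X that by (metis Int_commute simplicial_complex_def)
    then show "S \<inter> T \<in> X"
      using X that unfolding simplicial_complex_def by blast
  qed
  have FT: "F x = H T x" if T: "T \<in> X" "aff_dim T = 3" "x \<in> T" for T x
  proof (cases "x \<in> \<Union> (skeleton 2 X)")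
    case True
    then obtain S where S: "S \<in> X" "aff_dim S \<le> 2" "x \<in> S"
      by (auto simp: skeleton_def)
    have "S \<inter> T \<noteq> T"
      using S T aff_dim_subset [of T S] by auto
    then have "x \<in> rel_frontier T"
      using face_of_subset_rel_frontier [OF face(2) [OF S(1) T(1)]] S T by blast
    then show ?thesis
      using True H(2) T by (simp add: F_def)
  next
    case False
    define T' where "T' = (SOME T. T \<in> X \<and> aff_dim T = 3 \<and> x \<in> T)"
    have T': "T' \<in> X \<and> aff_dim T' = 3 \<and> x \<in> T'"
      unfolding T'_def by (rule someI [of _ T]) (use T in simp)
    have "T' \<inter> T = T"
    proof (rule ccontr)
      assume "T' \<inter> T \<noteq> T"
      then have "aff_dim (T' \<inter> T) < 3"
        using face_of_aff_dim_lt [OF convex [of T] face(2) [of T' T]] T T' by simp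
      then have "T' \<inter> T \<in> skeleton 2 X"
        using face(1) T T' by (simp add: skeleton_def)
      with False T T' show False by blast
    qed
    moreover have "T' \<inter> T = T'"
    proof (rule ccontr)
      assume "T' \<inter> T \<noteq> T'"
      then have "aff_dim (T' \<inter> T) < 3"
        using face_of_aff_dim_lt [OF convex [of T'] face(2) [of T T']] T T' by (simp add: Int_commute)
      then have "T' \<inter> T \<in> skeleton 2 X"
        using face(1) T T' by (simp add: skeleton_def)
      with False T T' show False by blast
    qed
    ultimately have "T' = T" by simp
    with False show ?thesis
      by (simp add: F_def T'_def)
  qed
  have FS: "continuous_map (top_of_set S) (nsphere n) F" if "S \<in> skeleton 3 X" for S
  proof (cases "aff_dim S \<le> 2")
    case True
    then have "S \<in> skeleton 2 X" using that by (simp add: skeleton_def)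
    then show ?thesis
      by (intro continuous_map_eq [OF f2]) (auto simp: F_def)
  next
    case False
    then have "S \<in> X" "aff_dim S = 3" using that by (auto simp: skeleton_def)
    then show ?thesis
      by (intro continuous_map_eq [OF H(1)]) (auto simp: FT)
  qed
  have "continuous_on (\<Union>S\<in>skeleton 3 X. S) F"
  proof (rule continuous_on_closed_Union)
    show "finite (skeleton 3 X)"
      using X by (simp add: skeleton_def simplicial_complex_def)
  qed (use FS closed in \<open>auto simp: continuous_map_nsphere_iff skeleton_def\<close>)
  moreover have "F \<in> \<Union> (skeleton 3 X) \<rightarrow> topspace (nsphere n)"
    using FS unfolding continuous_map_nsphere_iff by blast
  ultimately have "continuous_map (top_of_set (\<Union> (skeleton 3 X))) (nsphere n) F"
    by (simp add: continuous_map_nsphere_iff)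
  then show ?thesis
    by (intro exI [of _ F]) (auto simp: F_def)
qed

theorem proposition6:
  fixes X :: "'a::euclidean_space set set"
    and r :: "('a \<times> 'a) set"
    and \<alpha> :: "'a set \<Rightarrow> int"
    and p :: "nat \<Rightarrow> real"
    and \<omega> :: "(nat \<Rightarrow> real) chain set"
    and \<alpha>_hat :: "'a \<Rightarrow> nat \<Rightarrow> real"
  assumes "simplicial_complex X"
    and "linear_order_on (complex_vertices X) r"
    and "\<alpha> \<in> cocycles2 r X"
    and "p \<in> topspace (nsphere 2)"
    and "sphere_orientation \<omega>"
    and "\<forall>v \<in> complex_vertices X. \<alpha>_hat v = p"
    and "\<forall>e \<in> X. 1 simplex e \<longrightarrow> (\<forall>x \<in> e. \<alpha>_hat x = p)"
    and "\<forall>\<phi> \<in> X. \<forall>a b c. simplex_in_order r [a, b, c] \<phi> \<longrightarrow>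
      (\<exists>g u. continuous_map (triangle_mod_boundary \<phi>) (nsphere 2) g \<and>
        g (rel_frontier \<phi>) = p \<and>
        quotient_orientation a b c \<phi> u \<and>
        has_degree (triangle_mod_boundary \<phi>) u \<omega> g (\<alpha> \<phi>) \<and>
        (\<forall>x \<in> \<phi>. \<alpha>_hat x = g (collapse (rel_frontier \<phi>) x)))"
  shows "\<exists>\<alpha>_tilde. continuous_map (top_of_set (\<Union> (skeleton 3 X))) (nsphere 2) \<alpha>_tilde \<and>
    (\<forall>x \<in> \<Union> (skeleton 2 X). \<alpha>_tilde x = \<alpha>_hat x)"
proof -
  note X = assms(1) and r = assms(2)
  have "\<omega> \<in> homologous_rel_set 2 (nsphere 2) {} ` singular_relcycle_set 2 (nsphere 2) {}"
    using assms(5) carrier_relative_homology_group [of 2 "nsphere 2" "{}"] by (simp add: sphere_orientation_def)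
  then obtain \<zeta> where \<zeta>: "singular_relcycle 2 (nsphere 2) {} \<zeta>" "\<omega> = homologous_rel_set 2 (nsphere 2) {} \<zeta>"
    by blast
  note tri = collapsed_triangle_map [OF _ assms(8) [rule_format] \<zeta>]
  have edge: "\<alpha>_hat z = p" if "convex hull {x, y} \<in> X" "z \<in> convex hull {x, y}" for x y z
  proof (cases "x = y")
    case True
    then show ?thesis
      using that assms(6) by (simp add: complex_vertices_def)
  next
    case False
    then show ?thesis
      using that assms(7) one_simplex_segment [of x y] by (simp add: segment_convex_hull)
  qed
  have f2: "continuous_map (top_of_set S) (nsphere 2) \<alpha>_hat" if "S \<in> skeleton 2 X" for S
  proof -
    have S: "S \<in> X" "aff_dim S \<le> 2" using that by (auto simp: skeleton_def)
    have "S = {} \<or> aff_dim S = int 0 \<or> aff_dim S = int 1 \<or> aff_dim S = int 2"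
      using S(2) aff_dim_geq [of S] aff_dim_empty [of S] by linarith
    then consider "S = {}" | "aff_dim S = int 0" | "aff_dim S = int 1" | "aff_dim S = int 2" by blast
    then show ?thesis
    proof cases
      case 1
      then show ?thesis by (simp add: continuous_map_nsphere_iff)
    next
      case 2
      obtain vs where "length vs = Suc 0" "simplex_in_order r vs S"
        using simplex_in_order_exists [OF X r S(1) 2] .
      then obtain x where "S = convex hull {x, x}"
        by (auto simp: length_Suc_conv simplex_in_order_def)
      then have "\<And>z. z \<in> S \<Longrightarrow> \<alpha>_hat z = p" using edge S by blast
      then show ?thesis
        using assms(4) by (simp add: continuous_map_nsphere_iff cong: continuous_on_cong)
    next
      case 3
      obtain vs where "length vs = Suc 1" "simplex_in_order r vs S"
        using simplex_in_order_exists [OF X r S(1) 3] .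
      then obtain x y where "S = convex hull {x, y}"
        by (auto simp: length_Suc_conv simplex_in_order_def)
      then have "\<And>z. z \<in> S \<Longrightarrow> \<alpha>_hat z = p" using edge S by blast
      then show ?thesis
        using assms(4) by (simp add: continuous_map_nsphere_iff cong: continuous_on_cong)
    next
      case 4
      obtain vs where "length vs = Suc 2" "simplex_in_order r vs S"
        using simplex_in_order_exists [OF X r S(1) 4] .
      then obtain a b c where "simplex_in_order r [a, b, c] S"
        by (auto simp: length_Suc_conv numeral_2_eq_2)
      then show ?thesis
        using tri(1) S by blast
    qed
  qed
  show ?thesis
  proof (rule extend_over_3_simplices [OF X f2])
    fix T assume T: "T \<in> X" "aff_dim T = 3"
    then have "aff_dim T = int 3" by simp
    then obtain vs where "length vs = Suc 3" "simplex_in_order r vs T"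
      using simplex_in_order_exists [OF X r T(1)] by blast
    then obtain a b c d where abcd: "simplex_in_order r [a, b, c, d] T"
      by (auto simp: length_Suc_conv numeral_3_eq_3)
    then have aff: "\<not> affine_dependent {a, b, c, d}" "distinct [a, b, c, d]" and Teq: "T = convex hull {a, b, c, d}"
      by (auto simp: simplex_in_order_def)
    have hull: "convex hull F \<in> X" if "F \<subseteq> {a, b, c, d}" for F
      using simplicial_complex_face [OF X _ aff(1) that] T Teq by simp
    have indep: "\<not> affine_dependent F" if "F \<subseteq> {a, b, c, d}" for F
      using affine_independent_subset [OF aff(1) that] .
    have ord: "simplex_in_order r [b, c, d] (convex hull {b, c, d})" "simplex_in_order r [a, c, d] (convex hull {a, c, d})"
      "simplex_in_order r [a, b, d] (convex hull {a, b, d})" "simplex_in_order r [a, b, c] (convex hull {a, b, c})"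
      using abcd indep by (auto simp: simplex_in_order_def)
    have obs: "obstruction (simplex_map 2 \<alpha>_hat (affine_triangle x y z)) = of_int (\<alpha> (convex hull {x, y, z})) * chain_obstruction \<zeta>"
      if "simplex_in_order r [x, y, z] (convex hull {x, y, z})" "{x, y, z} \<subseteq> {a, b, c, d}" for x y z
      using tri(2) [OF that(1) hull [OF that(2)] that(1)] .
    have "\<alpha> (convex hull {b, c, d}) - \<alpha> (convex hull {a, c, d}) + \<alpha> (convex hull {a, b, d}) - \<alpha> (convex hull {a, b, c}) = 0"
      using assms(3) T abcd unfolding cocycles2_def by blast
    then have "of_int (\<alpha> (convex hull {b, c, d}) - \<alpha> (convex hull {a, c, d}) + \<alpha> (convex hull {a, b, d})
        - \<alpha> (convex hull {a, b, c})) * chain_obstruction \<zeta> = 0"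
      by (simp only: of_int_0 mult_zero_left)
    then have cocycle: "obstruction (simplex_map 2 \<alpha>_hat (affine_triangle b c d))
      - obstruction (simplex_map 2 \<alpha>_hat (affine_triangle a c d))
      + obstruction (simplex_map 2 \<alpha>_hat (affine_triangle a b d))
      - obstruction (simplex_map 2 \<alpha>_hat (affine_triangle a b c)) = 0"
      using obs [OF ord(1)] obs [OF ord(2)] obs [OF ord(3)] obs [OF ord(4)]
      by (simp add: algebra_simps)
    have edges: "\<forall>x \<in> {a, b, c, d}. \<forall>y \<in> {a, b, c, d}. \<forall>z \<in> convex hull {x, y}. \<alpha>_hat z = p"
    proof (intro ballI)
      fix x y z assume "x \<in> {a, b, c, d}" "y \<in> {a, b, c, d}" "z \<in> convex hull {x, y}"
      then show "\<alpha>_hat z = p"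
        by (intro edge [of x y] hull) simp_all
    qed
    have face: "continuous_map (top_of_set (convex hull ({a, b, c, d} - {x}))) (nsphere 2) \<alpha>_hat"
      if x: "x \<in> {a, b, c, d}" for x
    proof (rule f2)
      have "card ({a, b, c, d} - {x}) = 3"
        using aff(2) x by (subst card_Diff_singleton) auto
      then have "aff_dim (convex hull ({a, b, c, d} - {x})) = 2"
        using aff_dim_affine_independent [OF indep [of "{a, b, c, d} - {x}"]] by (simp add: aff_dim_convex_hull)
      then show "convex hull ({a, b, c, d} - {x}) \<in> skeleton 2 X"
        using hull [of "{a, b, c, d} - {x}"] by (auto simp: skeleton_def)
    qed
    have frontier: "rel_frontier (convex hull {a, b, c, d}) = (\<Union>x\<in>{a, b, c, d}. convex hull ({a, b, c, d} - {x}))"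
      by (simp only: rel_frontier_convex_hull_cases [OF aff(1)] Setcompr_eq_image)
    have "continuous_on (rel_frontier (convex hull {a, b, c, d})) \<alpha>_hat"
      unfolding frontier
    proof (rule continuous_on_closed_Union)
      show "closed (convex hull ({a, b, c, d} - {x}))" for x
        by (intro compact_imp_closed finite_imp_compact_convex_hull) simp
      show "continuous_on (convex hull ({a, b, c, d} - {x})) \<alpha>_hat" if "x \<in> {a, b, c, d}" for x
        using face [OF that] by (simp add: continuous_map_nsphere_iff)
    qed simp
    moreover have "\<alpha>_hat \<in> rel_frontier (convex hull {a, b, c, d}) \<rightarrow> topspace (nsphere 2)"
    proof
      fix z assume "z \<in> rel_frontier (convex hull {a, b, c, d})"
      then obtain x where "x \<in> {a, b, c, d}" "z \<in> convex hull ({a, b, c, d} - {x})"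
        unfolding frontier by blast
      with face [of x] show "\<alpha>_hat z \<in> topspace (nsphere 2)"
        unfolding continuous_map_nsphere_iff by blast
    qed
    ultimately obtain F where "continuous_on T F" "F \<in> T \<rightarrow> topspace (nsphere 2)"
      "\<And>x. x \<in> rel_frontier T \<Longrightarrow> F x = \<alpha>_hat x"
      using tetrahedron_extension [OF aff _ _ edges cocycle] unfolding Teq by blast
    then show "\<exists>F. continuous_map (top_of_set T) (nsphere 2) F \<and> (\<forall>x \<in> rel_frontier T. F x = \<alpha>_hat x)"
      by (intro exI [of _ F]) (simp add: continuous_map_nsphere_iff)
  qed
qed

end
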